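(* Let $X_1,X_2,\dots$ be i.i.d. real random variables with $\mathbb{E}(X_1)=0$ and $0<\operatorname{Var}(X_1)<\infty$, and let $S(n)=\sum_{i=1}^{n}X_i$ for $n\ge 0$ (so $S(0)=0$). Then for all $n$ large enough (with threshold not depending on $\ell$), for all positive integers $\ell$, $$\mathbb{P}\left(\operatorname{LIS}(S|_{[0,n)})\geq \ell \sqrt{n}\, 2^{5\sqrt{\log_4 n\,(\log_4\log_4 n)}}\right)\leq\left(\frac{2}{\log_4 n}\right)^{2\ell}.$$ Moreover, if $\mathbb{E}e^{t|X_1|}<\infty$ for some $t>0$, then for all $n$ large enough, for all positive integers $\ell$, $$\mathbb{P}\left(\operatorname{LIS}(S|_{[0,n)})\geq \ell \sqrt{n}\, 2^{5\sqrt{\log_4 n\,(\log_4\log_4 n)}}\right)\leq n^{-\ell/2}.$$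
   Context: $\mathbb{N}=\{0,1,2,\dots\}$, and $[0,n)$ denotes $\{0,1,\dots,n-1\}$. For $S\colon\mathbb{N}\to\mathbb{R}$ and $A\subset\mathbb{N}$, $S|_A$ is called increasing if $S(a)\le S(b)$ for all $a,b\in A$ with $a\le b$ (weakly increasing). Define $\operatorname{LIS}(S|_{[0,n)})=\max\{|A|: A\subset[0,n),\ S|_A \text{ is increasing}\}$. *)

theory Defs
  imports "HOL-Probability.Probability"
begin

(* Max ranges over a finite set that contains card {} = 0, so it is a genuine maximum. *)
definition LIS :: "(nat \<Rightarrow> real) \<Rightarrow> nat \<Rightarrow> nat" where
  "LIS f n = Max {card A | A. A \<subseteq> {0..<n} \<and> mono_on A f}"

(* The steps are X 1, X 2, ...; the value X 0 is not used. *)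
definition partial_sum :: "(nat \<Rightarrow> 'a \<Rightarrow> real) \<Rightarrow> 'a \<Rightarrow> nat \<Rightarrow> real" where
  "partial_sum X \<omega> n = (\<Sum>i=1..n. X i \<omega>)"

end

theory Submission
  imports Defs "HOL-Real_Asymp.Real_Asymp"
begin

text \<open>
  Write N = log 4 n, so that sqrt n = 2 powr N. The bound comes from a multiscale covering of an
  increasing set of times A. Fix K and consider the time scales m = K * K^(2j), on each of which the
  walk moves by about sqrt m. The only probabilistic input at a scale is that the walk does not
  return to its present level too often: among the K^2 blocks of length m that follow a time k, only
  s * O(K) are visited while the walk is within sqrt m of S k, except with probability 2^-s
  (level_hits_tail). The expected number of visited blocks is O(K), since the d-th block is visited
  with probability O(1 / sqrt d); the exponential tail follows by restarting the walk each time that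
  another O(K) blocks have been visited. With s = 4 N this holds simultaneously for all n times and
  all scales.

  On that event the path is deterministic. Let A be increasing, of duration at most K^2 * m and of
  height H (the total increase of the path along A). Cut A into 1 + H / sqrt m pieces of height at
  most sqrt m. All points of a piece are close in value to its first point, so the piece meets only
  v = s * O(K) blocks of length m, and the heights of its parts in these blocks add up to at most its
  own height, because A is increasing. Hence a bound card A \<le> \<alpha> + \<beta> H at scale m implies
  card A \<le> v \<alpha> + (\<beta> + v \<alpha> / sqrt m) H at scale K^2 * m (card_increasing_le). After J scales,
  K^J being about sqrt n, this is sqrt n times (O(s))^J and a few factors K, as long as H exceeds
  sqrt n by no more than a factor 2 powr (L / 2). With L = sqrt (N * log 4 N), K about 2 powr L and
  J about N / L, the factors (O(N))^J and K^2 are each 2 powr (2 L + o(L)), so that a set with more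
  than sqrt n * 2 powr (5 L) elements cannot be increasing (scale_parameters).

  The failure probability is dominated by the event that the range of the walk exceeds
  2 powr (L / 2) * sqrt n. Second moments bound it by O(2 powr (- L)), which is o(1 / N^2), and
  exponential moments by exp (- 2 powr (L / 2) / 2 + O(1)), which is o(1 / sqrt n). This settles
  l = 1. For general l, cut time whenever the longest increasing subsequence of the current piece
  reaches the threshold: l pieces have to fit into n steps, and by independence this costs the l-th
  power of the bound for one piece (prob_LIS_power).
\<close>

section \<open>Random walks, their past and their future\<close>

locale random_walk = prob_space M for M :: "'a measure" +
  fixes X :: "nat \<Rightarrow> 'a \<Rightarrow> real" and \<sigma> :: real
  assumes indep: "indep_vars (\<lambda>_. borel) X {1..}"
    and ident: "\<And>i. i \<ge> 1 \<Longrightarrow> distr M borel (X i) = distr M borel (X 1)"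
    and square_integrable: "integrable M (\<lambda>\<omega>. (X 1 \<omega>)\<^sup>2)"
    and mean: "expectation (X 1) = 0"
    and \<sigma>_pos: "0 < \<sigma>"
    and variance: "variance (X 1) = \<sigma>\<^sup>2"
begin

abbreviation S :: "nat \<Rightarrow> 'a \<Rightarrow> real" where
  "S t \<omega> \<equiv> partial_sum X \<omega> t"

lemma S_diff: "k \<le> u \<Longrightarrow> S u \<omega> - S k \<omega> = (\<Sum>i\<in>{k<..u}. X i \<omega>)"
proof -
  assume "k \<le> u"
  then have "{1..u} = {1..k} \<union> {k<..u}" by auto
  then have "(\<Sum>i\<in>{1..u}. X i \<omega>) = (\<Sum>i\<in>{1..k}. X i \<omega>) + (\<Sum>i\<in>{k<..u}. X i \<omega>)"
    by (simp only:) (rule sum.union_disjoint, auto)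
  then show ?thesis by (simp add: partial_sum_def)
qed

lemma X_measurable: "i \<ge> 1 \<Longrightarrow> X i \<in> borel_measurable M"
  using indep by (auto simp: indep_vars_def2)

lemma S_measurable [measurable]: "S t \<in> borel_measurable M"
  unfolding partial_sum_def by (rule borel_measurable_sum) (auto intro: X_measurable)

text \<open>
  The information in the steps with index in I. Allowing any index set treats the past {1..t} and the
  future {t<..} alike.
\<close>
definition hist :: "nat set \<Rightarrow> 'a measure" where
  "hist I = sigma (space M) (\<Union>i\<in>I. {X i -` A \<inter> space M | A. A \<in> sets borel})"

lemma space_hist [simp]: "space (hist I) = space M"
  unfolding hist_def by (rule space_measure_of) auto

lemma sets_hist: "sets (hist I) = sigma_sets (space M) (\<Union>i\<in>I. {X i -` A \<inter> space M | A. A \<in> sets borel})"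
  unfolding hist_def by (rule sets_measure_of) auto

lemma X_hist: "i \<in> I \<Longrightarrow> X i \<in> borel_measurable (hist I)"
  by (rule measurableI) (auto simp: sets_hist intro!: sigma_sets.Basic)

lemma hist_subset: "I \<subseteq> {1..} \<Longrightarrow> sets (hist I) \<subseteq> events"
  unfolding sets_hist
proof (rule sets.sigma_sets_subset)
  assume I: "I \<subseteq> {1..}"
  show "(\<Union>i\<in>I. {X i -` A \<inter> space M |A. A \<in> sets borel}) \<subseteq> events"
  proof clarify
    fix i and A :: "real set" assume "i \<in> I" "A \<in> sets borel"
    with I X_measurable[of i] show "X i -` A \<inter> space M \<in> events"
      by (auto intro: measurable_sets)
  qed
qed

lemma pred_hist: "I \<subseteq> {1..} \<Longrightarrow> Measurable.pred (hist I) P \<Longrightarrow> Measurable.pred M P"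
  using hist_subset[of I] unfolding pred_def by auto

lemma hist_mono: "I \<subseteq> J \<Longrightarrow> sets (hist I) \<subseteq> sets (hist J)"
  unfolding sets_hist by (rule sigma_sets_mono'') (auto intro: sigma_sets.Basic sigma_sets_top)

lemma pred_hist_mono: "I \<subseteq> J \<Longrightarrow> Measurable.pred (hist I) P \<Longrightarrow> Measurable.pred (hist J) P"
  using hist_mono[of I J] unfolding pred_def by auto

lemma S_past: "u \<le> t \<Longrightarrow> S u \<in> borel_measurable (hist {1..t})"
  unfolding partial_sum_def by (rule borel_measurable_sum) (auto intro: X_hist)

lemma S_future: "t \<le> u \<Longrightarrow> (\<lambda>\<omega>. S u \<omega> - S t \<omega>) \<in> borel_measurable (hist {t<..})"
  by (simp add: S_diff) (rule borel_measurable_sum, auto intro: X_hist)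

lemma prob_past_future:
  assumes P: "Measurable.pred (hist {1..t}) P" and Q: "Measurable.pred (hist {t<..}) Q"
  shows "\<P>(\<omega> in M. P \<omega> \<and> Q \<omega>) = \<P>(\<omega> in M. P \<omega>) * \<P>(\<omega> in M. Q \<omega>)"
proof -
  let ?E = "\<lambda>i. {X i -` A \<inter> space M | A. A \<in> sets borel}"
  let ?I = "case_bool {1..t} {t<..}"
  have "indep_sets (\<lambda>b. sigma_sets (space M) (\<Union>i\<in>?I b. ?E i)) UNIV"
  proof (rule indep_sets_collect_sigma)
    have "indep_sets ?E {1..}" using indep by (simp add: indep_vars_def2)
    then show "indep_sets ?E (\<Union>b\<in>UNIV. ?I b)"
      by (rule indep_sets_mono_index[rotated]) (auto simp: UNIV_bool)
    show "Int_stable (?E i)" for i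
    proof (rule Int_stableI)
      fix a b assume "a \<in> ?E i" "b \<in> ?E i"
      then obtain A B where "a = X i -` A \<inter> space M" "b = X i -` B \<inter> space M"
        "A \<in> sets borel" "B \<in> sets borel" by auto
      then show "a \<inter> b \<in> ?E i" by (auto intro!: exI[of _ "A \<inter> B"])
    qed
    show "disjoint_family_on ?I UNIV"
      by (auto simp: disjoint_family_on_def split: bool.split)
  qed
  moreover have "(\<lambda>b. sigma_sets (space M) (\<Union>i\<in>?I b. ?E i))
      = case_bool (sets (hist {1..t})) (sets (hist {t<..}))"
    by (auto simp: sets_hist fun_eq_iff split: bool.split)
  ultimately have "indep_set (sets (hist {1..t})) (sets (hist {t<..}))"
    by (simp add: indep_set_def)
  from indep_setD[OF this, of "{\<omega>\<in>space M. P \<omega>}" "{\<omega>\<in>space M. Q \<omega>}"] P Q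
  have "prob ({\<omega>\<in>space M. P \<omega>} \<inter> {\<omega>\<in>space M. Q \<omega>}) = \<P>(\<omega> in M. P \<omega>) * \<P>(\<omega> in M. Q \<omega>)"
    by (auto simp: pred_def)
  moreover have "{\<omega>\<in>space M. P \<omega>} \<inter> {\<omega>\<in>space M. Q \<omega>} = {\<omega>\<in>space M. P \<omega> \<and> Q \<omega>}"
    by blast
  ultimately show ?thesis by simp
qed

definition first :: "(nat \<Rightarrow> 'a \<Rightarrow> bool) \<Rightarrow> nat \<Rightarrow> 'a \<Rightarrow> bool" where
  "first E t \<omega> \<longleftrightarrow> E t \<omega> \<and> (\<forall>u<t. \<not> E u \<omega>)"

lemma ex_first: "t < T \<Longrightarrow> E t \<omega> \<Longrightarrow> \<exists>t<T. first E t \<omega>"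
  unfolding first_def
  by (rule exI[of _ "LEAST t. E t \<omega>"])
     (metis LeastI le_less_trans[OF Least_le] not_less_Least)

lemma first_past:
  assumes "\<And>t. t < T \<Longrightarrow> Measurable.pred (hist {1..t}) (E t)" "t < T"
  shows "Measurable.pred (hist {1..t}) (first E t)"
proof -
  have "Measurable.pred (hist {1..t}) (E u)" if "u \<le> t" for u
    using pred_hist_mono[of "{1..u}" "{1..t}" "E u"] assms that by auto
  then show ?thesis unfolding first_def by (intro pred_intros_logic pred_intros_finite) auto
qed

text \<open>
  The events that t is the first time at which E holds are disjoint and depend on the past of t only.
  This is all of the strong Markov property that is used below.
\<close>
lemma prob_first_passage:
  assumes E: "\<And>t. t < T \<Longrightarrow> Measurable.pred (hist {1..t}) (E t)"
    and G: "\<And>t. t < T \<Longrightarrow> Measurable.pred (hist {t<..}) (G t)"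
  shows "\<P>(\<omega> in M. \<exists>t<T. first E t \<omega> \<and> G t \<omega>)
    = (\<Sum>t<T. \<P>(\<omega> in M. first E t \<omega>) * \<P>(\<omega> in M. G t \<omega>))"
proof -
  have F: "Measurable.pred M (first E t)" if "t < T" for t
    using first_past[OF E that] by (rule pred_hist[rotated]) auto
  have GM: "Measurable.pred M (G t)" if "t < T" for t
    using G[OF that] by (rule pred_hist[rotated]) auto
  have "\<P>(\<omega> in M. \<exists>t<T. first E t \<omega> \<and> G t \<omega>) = prob (\<Union>t<T. {\<omega>\<in>space M. first E t \<omega> \<and> G t \<omega>})"
    by (rule arg_cong[where f=prob]) auto
  also have "\<dots> = (\<Sum>t<T. \<P>(\<omega> in M. first E t \<omega> \<and> G t \<omega>))"
  proof (rule finite_measure_finite_Union)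
    show "(\<lambda>t. {\<omega>\<in>space M. first E t \<omega> \<and> G t \<omega>}) ` {..<T} \<subseteq> events"
      using F GM by auto
    show "disjoint_family_on (\<lambda>t. {\<omega>\<in>space M. first E t \<omega> \<and> G t \<omega>}) {..<T}"
      unfolding disjoint_family_on_def first_def by (auto dest: linorder_neqE_nat)
  qed auto
  also have "\<dots> = (\<Sum>t<T. \<P>(\<omega> in M. first E t \<omega>) * \<P>(\<omega> in M. G t \<omega>))"
  proof (rule sum.cong)
    fix t assume "t \<in> {..<T}"
    then show "\<P>(\<omega> in M. first E t \<omega> \<and> G t \<omega>) = \<P>(\<omega> in M. first E t \<omega>) * \<P>(\<omega> in M. G t \<omega>)"
      by (intro prob_past_future[where t=t] first_past[where T=T] E G) auto
  qed simp
  finally show ?thesis .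
qed

lemma prob_first_sum:
  assumes E: "\<And>t. t < T \<Longrightarrow> Measurable.pred (hist {1..t}) (E t)"
  shows "(\<Sum>t<T. \<P>(\<omega> in M. first E t \<omega>)) = \<P>(\<omega> in M. \<exists>t<T. E t \<omega>)"
proof -
  have "(\<Sum>t<T. \<P>(\<omega> in M. first E t \<omega>)) = \<P>(\<omega> in M. \<exists>t<T. first E t \<omega> \<and> True)"
    by (subst prob_first_passage[of T E "\<lambda>_ _. True", OF E]) (auto simp: prob_space)
  also have "\<dots> = \<P>(\<omega> in M. \<exists>t<T. E t \<omega>)"
    using ex_first[of _ T E] by (intro arg_cong[where f=prob]) (auto simp: first_def)
  finally show ?thesis .
qed

lemma prob_first_passage_le:
  assumes E: "\<And>t. t < T \<Longrightarrow> Measurable.pred (hist {1..t}) (E t)"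
    and G: "\<And>t. t < T \<Longrightarrow> Measurable.pred (hist {t<..}) (G t)"
    and le: "\<And>t. t < T \<Longrightarrow> \<P>(\<omega> in M. G t \<omega>) \<le> c"
    and D: "\<And>\<omega>. \<omega> \<in> space M \<Longrightarrow> D \<omega> \<Longrightarrow> \<exists>t<T. first E t \<omega> \<and> G t \<omega>"
  shows "\<P>(\<omega> in M. D \<omega>) \<le> c * \<P>(\<omega> in M. \<exists>t<T. E t \<omega>)"
proof -
  have F: "Measurable.pred M (first E t)" if "t < T" for t
    using first_past[OF E that] by (rule pred_hist[rotated]) auto
  have GM: "Measurable.pred M (G t)" if "t < T" for t
    using G[OF that] by (rule pred_hist[rotated]) auto
  have "Measurable.pred M (\<lambda>\<omega>. \<exists>t\<in>{..<T}. first E t \<omega> \<and> G t \<omega>)"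
    using F GM by (intro pred_intros_finite pred_intros_logic) auto
  then have ev: "{\<omega>\<in>space M. \<exists>t<T. first E t \<omega> \<and> G t \<omega>} \<in> events"
    by (simp only: pred_def Bex_def lessThan_iff space_hist)
  have "\<P>(\<omega> in M. D \<omega>) \<le> \<P>(\<omega> in M. \<exists>t<T. first E t \<omega> \<and> G t \<omega>)"
    using D by (intro finite_measure_mono ev) blast
  also have "\<dots> \<le> (\<Sum>t<T. \<P>(\<omega> in M. first E t \<omega>) * c)"
    by (subst prob_first_passage[OF E G]) (auto intro!: sum_mono mult_left_mono le)
  also have "\<dots> = \<P>(\<omega> in M. \<exists>t<T. E t \<omega>) * c"
    by (simp only: sum_distrib_right[symmetric] prob_first_sum[of T E, OF E])
  also have "\<dots> = c * \<P>(\<omega> in M. \<exists>t<T. E t \<omega>)"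
    by simp
  finally show ?thesis .
qed

lemma prob_first_passage_ge:
  assumes E: "\<And>t. t < T \<Longrightarrow> Measurable.pred (hist {1..t}) (E t)"
    and G: "\<And>t. t < T \<Longrightarrow> Measurable.pred (hist {t<..}) (G t)"
    and ge: "\<And>t. t < T \<Longrightarrow> c \<le> \<P>(\<omega> in M. G t \<omega>)"
    and D: "\<And>t \<omega>. t < T \<Longrightarrow> \<omega> \<in> space M \<Longrightarrow> E t \<omega> \<Longrightarrow> G t \<omega> \<Longrightarrow> D \<omega>"
    and DM: "Measurable.pred M D"
  shows "c * \<P>(\<omega> in M. \<exists>t<T. E t \<omega>) \<le> \<P>(\<omega> in M. D \<omega>)"
proof -
  have "c * \<P>(\<omega> in M. \<exists>t<T. E t \<omega>) = \<P>(\<omega> in M. \<exists>t<T. E t \<omega>) * c"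
    by simp
  also have "\<dots> = (\<Sum>t<T. \<P>(\<omega> in M. first E t \<omega>) * c)"
    by (simp only: sum_distrib_right[symmetric] prob_first_sum[of T E, OF E])
  also have "\<dots> \<le> \<P>(\<omega> in M. \<exists>t<T. first E t \<omega> \<and> G t \<omega>)"
    by (subst prob_first_passage[OF E G]) (auto intro!: sum_mono mult_left_mono ge)
  also have "\<dots> \<le> \<P>(\<omega> in M. D \<omega>)"
    using D DM by (intro finite_measure_mono) (auto simp: first_def)
  finally show ?thesis .
qed

end

section \<open>Concentration of the walk\<close>

text \<open>
  The Gaussian kernel is its own Fourier transform: exchanging the two integrations turns the average
  of the kernel into a Gaussian average of the characteristic function.
\<close>
lemma gauss_average_le_char:
  fixes \<nu> :: "real measure" and w :: real
  assumes "real_distribution \<nu>"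
  shows "(LINT x|\<nu>. exp (- (x / w)\<^sup>2 / 2)) \<le> (LINT g|std_normal_distribution. cmod (char \<nu> (g / w)))"
proof -
  let ?N = std_normal_distribution
  interpret N: real_distribution ?N by (rule real_dist_normal_dist)
  interpret V: real_distribution \<nu> by (rule assms)
  interpret P: pair_prob_space \<nu> ?N ..
  have "complex_of_real (LINT x|\<nu>. exp (- (x / w)\<^sup>2 / 2)) = (CLINT x|\<nu>. char ?N (x / w))"
    by (simp add: char_std_normal_distribution)
  also have "\<dots> = (CLINT x|\<nu>. CLINT g|?N. iexp (x / w * g))"
    by (simp add: char_def)
  also have "\<dots> = (CLINT g|?N. CLINT x|\<nu>. iexp (x / w * g))"
    by (rule P.Fubini_integral[symmetric])
       (auto intro!: P.integrable_const_bound[where B=1] simp: norm_exp_i_times split: prod.split)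
  also have "\<dots> = (CLINT g|?N. char \<nu> (g / w))"
    by (simp add: char_def mult.commute)
  finally have "(LINT x|\<nu>. exp (- (x / w)\<^sup>2 / 2)) \<le> cmod (CLINT g|?N. char \<nu> (g / w))"
    by (metis abs_ge_self norm_of_real)
  also have "\<dots> \<le> (LINT g|?N. cmod (char \<nu> (g / w)))"
    by (rule integral_norm_bound)
  finally show ?thesis .
qed

text \<open>
  Bounding the standard normal density by its maximum leaves the integral of another normal density,
  of variance 1 / (2 a).
\<close>
lemma gauss_exp_square_le:
  fixes a :: real
  assumes "a > 0"
  shows "(LINT g|std_normal_distribution. exp (- a * g\<^sup>2)) \<le> 1 / sqrt (2 * a)"
proof -
  let ?s = "1 / sqrt (2 * a)"
  have nd: "exp (- a * g\<^sup>2) = ?s * sqrt (2 * pi) * normal_density 0 ?s g" for g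
  proof -
    have "2 * (?s)\<^sup>2 = 1 / a" using assms by (simp add: power_divide)
    moreover have "sqrt (2 * pi * (?s)\<^sup>2) = ?s * sqrt (2 * pi)"
      using assms by (simp add: real_sqrt_mult power_divide real_sqrt_divide)
    ultimately show ?thesis using assms by (simp add: normal_density_def)
  qed
  have "(LINT g|std_normal_distribution. exp (- a * g\<^sup>2))
      = (LINT g|lborel. std_normal_density g * exp (- a * g\<^sup>2))"
    by (subst integral_density) auto
  also have "\<dots> \<le> (LINT g|lborel. ?s * normal_density 0 ?s g)"
  proof (rule integral_mono_AE)
    have "integrable lborel (\<lambda>g. std_normal_density g * exp (- a * g\<^sup>2))"
      by (rule Bochner_Integration.integrable_bound[of _ "std_normal_density"])
         (use assms in \<open>auto simp: mult_left_le\<close>)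
    then show "integrable lborel (\<lambda>g. std_normal_density g * exp (- a * g\<^sup>2))" .
    show "integrable lborel (\<lambda>g. ?s * normal_density 0 ?s g)"
      using assms by auto
    have "std_normal_density g * exp (- a * g\<^sup>2) \<le> ?s * normal_density 0 ?s g" for g
    proof -
      have "std_normal_density g \<le> 1 / sqrt (2 * pi)"
        by (simp add: std_normal_density_def divide_right_mono)
      then have "std_normal_density g * exp (- a * g\<^sup>2) \<le> 1 / sqrt (2 * pi) * exp (- a * g\<^sup>2)"
        by (rule mult_right_mono) simp
      also have "\<dots> = ?s * normal_density 0 ?s g"
        by (subst nd) (simp add: field_simps)
      finally show ?thesis .
    qed
    then show "AE g in lborel. std_normal_density g * exp (- a * g\<^sup>2) \<le> ?s * normal_density 0 ?s g"
      by simp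
  qed
  also have "\<dots> = ?s" using assms by simp
  finally show ?thesis .
qed

text \<open>
  On the interval of radius w the Gaussian kernel of width w is at least exp (-1/2).
\<close>
lemma prob_small_le_char:
  fixes \<nu> :: "real measure" and w :: real
  assumes "real_distribution \<nu>" and w: "w > 0"
  shows "measure \<nu> {x. \<bar>x\<bar> \<le> w} \<le> exp (1/2) * (LINT g|std_normal_distribution. cmod (char \<nu> (g / w)))"
proof -
  interpret V: real_distribution \<nu> by (rule assms)
  have int: "integrable \<nu> (\<lambda>x. exp (- (x / w)\<^sup>2 / 2))"
    by (rule V.integrable_const_bound[where B=1]) auto
  have "exp (-1/2 :: real) * measure \<nu> {x. \<bar>x\<bar> \<le> w} = (LINT x|\<nu>. exp (-1/2 :: real) * indicator {x. \<bar>x\<bar> \<le> w} x)"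
    by simp
  also have "\<dots> \<le> (LINT x|\<nu>. exp (- (x / w)\<^sup>2 / 2))"
  proof (rule integral_mono[OF _ int])
    show "integrable \<nu> (\<lambda>x. exp (-1/2 :: real) * indicator {x. \<bar>x\<bar> \<le> w} x)"
      by (rule V.integrable_const_bound[where B="exp (-1/2)"]) (auto simp: indicator_def)
    fix x
    have "(x / w)\<^sup>2 \<le> 1" if "\<bar>x\<bar> \<le> w"
      using that w by (simp add: power_divide divide_le_eq_1 abs_le_square_iff[symmetric])
    then show "exp (-1/2 :: real) * indicator {x. \<bar>x\<bar> \<le> w} x \<le> exp (- (x / w)\<^sup>2 / 2)"
      by (auto simp: indicator_def)
  qed
  also have "\<dots> \<le> (LINT g|std_normal_distribution. cmod (char \<nu> (g / w)))"
    by (rule gauss_average_le_char[OF assms(1)])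
  finally show ?thesis
    by (simp add: exp_minus field_simps)
qed

context random_walk
begin

lemma moments:
  assumes "i \<ge> 1"
  shows "integrable M (\<lambda>\<omega>. (X i \<omega>)\<^sup>2)" "integrable M (X i)" "expectation (X i) = 0"
    "expectation (\<lambda>\<omega>. (X i \<omega>)\<^sup>2) = \<sigma>\<^sup>2"
proof -
  note [measurable] = X_measurable[OF assms] X_measurable[of 1, OF order_refl]
  have t: "(LINT \<omega>|M. f (X i \<omega>)) = (LINT \<omega>|M. f (X 1 \<omega>))"
       "integrable M (\<lambda>\<omega>. f (X i \<omega>)) \<longleftrightarrow> integrable M (\<lambda>\<omega>. f (X 1 \<omega>))"
      if [measurable]: "f \<in> borel_measurable borel" for f :: "real \<Rightarrow> real"
  proof -
    have "(LINT \<omega>|M. f (X i \<omega>)) = (LINT x|distr M borel (X i). f x)"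
      by (rule integral_distr[symmetric]) measurable
    also have "\<dots> = (LINT \<omega>|M. f (X 1 \<omega>))"
      unfolding ident[OF assms] by (rule integral_distr) measurable
    finally show "(LINT \<omega>|M. f (X i \<omega>)) = (LINT \<omega>|M. f (X 1 \<omega>))" .
    have "integrable M (\<lambda>\<omega>. f (X i \<omega>)) \<longleftrightarrow> integrable (distr M borel (X i)) f"
      by (rule integrable_distr_eq[symmetric]) measurable
    also have "\<dots> \<longleftrightarrow> integrable M (\<lambda>\<omega>. f (X 1 \<omega>))"
      unfolding ident[OF assms] by (rule integrable_distr_eq) measurable
    finally show "integrable M (\<lambda>\<omega>. f (X i \<omega>)) \<longleftrightarrow> integrable M (\<lambda>\<omega>. f (X 1 \<omega>))" .
  qed
  show sq: "integrable M (\<lambda>\<omega>. (X i \<omega>)\<^sup>2)" using t(2)[of "\<lambda>x. x\<^sup>2"] square_integrable by simp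
  then show "integrable M (X i)" by (rule square_integrable_imp_integrable[rotated]) simp
  show "expectation (X i) = 0" using t(1)[of "\<lambda>x. x"] mean by simp
  show "expectation (\<lambda>\<omega>. (X i \<omega>)\<^sup>2) = \<sigma>\<^sup>2" using t(1)[of "\<lambda>x. x\<^sup>2"] variance mean by simp
qed

lemma increment_moments:
  shows "integrable M (\<lambda>\<omega>. (S (k + T) \<omega> - S k \<omega>)\<^sup>2)" 
    "expectation (\<lambda>\<omega>. (S (k + T) \<omega> - S k \<omega>)\<^sup>2) = \<sigma>\<^sup>2 * T"
proof -
  have "integrable M (\<lambda>\<omega>. (S (k + T) \<omega> - S k \<omega>)\<^sup>2) \<and> integrable M (\<lambda>\<omega>. S (k + T) \<omega> - S k \<omega>)
    \<and> expectation (\<lambda>\<omega>. (S (k + T) \<omega> - S k \<omega>)\<^sup>2) = \<sigma>\<^sup>2 * T"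
  proof (induction T)
    case (Suc T)
    let ?x = "X (Suc (k + T))" and ?s = "\<lambda>\<omega>. S (k + T) \<omega> - S k \<omega>"
    have mx: "integrable M (\<lambda>\<omega>. (?x \<omega>)\<^sup>2)" "integrable M ?x" "expectation ?x = 0"
      "expectation (\<lambda>\<omega>. (?x \<omega>)\<^sup>2) = \<sigma>\<^sup>2"
      by (intro moments; simp)+
    have "indep_var borel ?x borel (\<lambda>\<omega>. \<Sum>i\<in>{k<..k+T}. X i \<omega>)"
      by (rule indep_vars_sum) (auto intro: indep_vars_subset[OF indep])
    then have iv: "indep_var borel ?x borel ?s" by (simp add: S_diff)
    have c: "expectation (\<lambda>\<omega>. ?x \<omega> * ?s \<omega>) = 0" "integrable M (\<lambda>\<omega>. ?x \<omega> * ?s \<omega>)"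
      using indep_var_lebesgue_integral[OF iv] indep_var_integrable[OF iv] mx Suc.IH by auto
    have e: "S (k + Suc T) \<omega> - S k \<omega> = ?s \<omega> + ?x \<omega>" for \<omega>
      by (simp add: partial_sum_def)
    have e2: "(?s \<omega> + ?x \<omega>)\<^sup>2 = (?s \<omega>)\<^sup>2 + (?x \<omega>)\<^sup>2 + 2 * (?x \<omega> * ?s \<omega>)" for \<omega>
      by (simp add: power2_eq_square algebra_simps)
    have "expectation (\<lambda>\<omega>. (?s \<omega>)\<^sup>2 + (?x \<omega>)\<^sup>2 + 2 * (?x \<omega> * ?s \<omega>)) = \<sigma>\<^sup>2 * T + \<sigma>\<^sup>2 + 2 * 0"
      using Suc.IH mx c by (simp only: Bochner_Integration.integral_add Bochner_Integration.integrable_add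
        integrable_mult_right integral_mult_right_zero simp_thms)
    moreover have "integrable M (\<lambda>\<omega>. (?s \<omega>)\<^sup>2 + (?x \<omega>)\<^sup>2 + 2 * (?x \<omega> * ?s \<omega>))"
      using Suc.IH mx c by (intro Bochner_Integration.integrable_add integrable_mult_right) auto
    moreover have "integrable M (\<lambda>\<omega>. ?s \<omega> + ?x \<omega>)"
      using Suc.IH mx by (intro Bochner_Integration.integrable_add) auto
    ultimately show ?case unfolding e e2 by (simp add: algebra_simps)
  qed simp
  then show "integrable M (\<lambda>\<omega>. (S (k + T) \<omega> - S k \<omega>)\<^sup>2)" 
    "expectation (\<lambda>\<omega>. (S (k + T) \<omega> - S k \<omega>)\<^sup>2) = \<sigma>\<^sup>2 * T" by auto
qed

lemma chebyshev:
  assumes "k \<le> u" "x > 0"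
  shows "\<P>(\<omega> in M. \<bar>S u \<omega> - S k \<omega>\<bar> \<ge> x) \<le> \<sigma>\<^sup>2 * real (u - k) / x\<^sup>2"
proof -
  obtain T where "u = k + T" using assms(1) le_Suc_ex by blast
  then show ?thesis
    using second_moment_method[of "\<lambda>\<omega>. S u \<omega> - S k \<omega>" x] increment_moments[of k T] assms(2) by simp
qed

text \<open>
  The characteristic function of a centred law is 1 - u^2 \<sigma>^2 / 2 + o(u^2).
\<close>
lemma char_near_zero:
  "\<exists>\<delta>>0. \<forall>u. \<bar>u\<bar> \<le> \<delta> \<longrightarrow> cmod (char (distr M borel (X 1)) u) \<le> exp (- (\<sigma>\<^sup>2 / 4) * u\<^sup>2)"
proof -
  define g where "g t = expectation (\<lambda>x. min (6 * (X 1 x)\<^sup>2) (\<bar>t\<bar> * \<bar>X 1 x\<bar>^3))" for t :: real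
  note [measurable] = X_measurable[of 1, OF order_refl]
  note m = moments[of 1, OF order_refl]
  have gint: "integrable M (\<lambda>x. min (6 * (X 1 x)\<^sup>2) (\<bar>t\<bar> * \<bar>X 1 x\<bar>^3))" for t
    by (rule Bochner_Integration.integrable_bound[of _ "\<lambda>x. 6 * (X 1 x)\<^sup>2"]) (use m in auto)
  have gmono: "g t \<le> g t'" if "\<bar>t\<bar> \<le> t'" for t t'
    unfolding g_def by (intro integral_mono gint min.mono mult_right_mono) (use that in auto)
  have "(\<lambda>n. g (1 / Suc n)) \<longlonglongrightarrow> (LINT x|M. 0)"
    unfolding g_def
  proof (rule integral_dominated_convergence[where w="\<lambda>x. 6 * (X 1 x)\<^sup>2"])
    have "(\<lambda>n. min (6 * y\<^sup>2) (\<bar>1 / real (Suc n)\<bar> * \<bar>y\<bar> ^ 3)) \<longlonglongrightarrow> min (6 * y\<^sup>2) (\<bar>0\<bar> * \<bar>y\<bar> ^ 3)" for y :: real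
      by (intro tendsto_intros LIMSEQ_Suc[OF lim_1_over_n])
    then show "AE x in M. (\<lambda>n. min (6 * (X 1 x)\<^sup>2) (\<bar>1 / real (Suc n)\<bar> * \<bar>X 1 x\<bar> ^ 3)) \<longlonglongrightarrow> 0"
      by simp
  qed (use m in auto)
  then have "\<forall>\<^sub>F n in sequentially. g (1 / Suc n) < 3 * \<sigma>\<^sup>2 / 2"
    using \<sigma>_pos by (intro order_tendstoD(2)) auto
  then obtain n where n: "g (1 / Suc n) < 3 * \<sigma>\<^sup>2 / 2" by (auto simp: eventually_sequentially)
  define \<delta> where "\<delta> = min (1 / Suc n) (1 / \<sigma>)"
  have "cmod (char (distr M borel (X 1)) u) \<le> exp (- (\<sigma>\<^sup>2 / 4) * u\<^sup>2)" if u: "\<bar>u\<bar> \<le> \<delta>" for u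
  proof -
    have "\<bar>u\<bar> * \<sigma> \<le> 1" using u \<sigma>_pos by (simp add: \<delta>_def field_simps)
    then have "(\<bar>u\<bar> * \<sigma>)\<^sup>2 \<le> 1" using \<sigma>_pos by (intro power_le_one) auto
    then have s: "u\<^sup>2 * \<sigma>\<^sup>2 \<le> 1" by (simp add: power_mult_distrib)
    have "g u \<le> 3 * \<sigma>\<^sup>2 / 2" using gmono[of u "1 / Suc n"] n u by (simp add: \<delta>_def)
    then have "u\<^sup>2 / 6 * g u \<le> u\<^sup>2 / 6 * (3 * \<sigma>\<^sup>2 / 2)" by (rule mult_left_mono) simp
    moreover have "cmod (char (distr M borel (X 1)) u - (1 - u\<^sup>2 * \<sigma>\<^sup>2 / 2)) \<le> u\<^sup>2 / 6 * g u"
      unfolding g_def by (rule char_approx3') (use m variance in auto)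
    ultimately have "cmod (char (distr M borel (X 1)) u - of_real (1 - u\<^sup>2 * \<sigma>\<^sup>2 / 2)) \<le> u\<^sup>2 * \<sigma>\<^sup>2 / 4"
      by (simp add: field_simps)
    then have "cmod (char (distr M borel (X 1)) u) \<le> cmod (of_real (1 - u\<^sup>2 * \<sigma>\<^sup>2 / 2)) + u\<^sup>2 * \<sigma>\<^sup>2 / 4"
      by (smt (verit) norm_triangle_sub)
    also have "cmod (of_real (1 - u\<^sup>2 * \<sigma>\<^sup>2 / 2)) = 1 - u\<^sup>2 * \<sigma>\<^sup>2 / 2"
      using s by (simp only: norm_of_real)
    also have "1 - u\<^sup>2 * \<sigma>\<^sup>2 / 2 + u\<^sup>2 * \<sigma>\<^sup>2 / 4 = 1 + (- (\<sigma>\<^sup>2 / 4) * u\<^sup>2)" by (simp add: field_simps)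
    also have "\<dots> \<le> exp (- (\<sigma>\<^sup>2 / 4) * u\<^sup>2)" by (rule exp_ge_add_one_self)
    finally show ?thesis .
  qed
  moreover have "\<delta> > 0" using \<sigma>_pos by (simp add: \<delta>_def)
  ultimately show ?thesis by blast
qed

lemma char_increment:
  "char (distr M borel (\<lambda>\<omega>. S (k + T) \<omega> - S k \<omega>)) u = (char (distr M borel (X 1)) u) ^ T"
proof -
  have "char (distr M borel (\<lambda>\<omega>. S (k + T) \<omega> - S k \<omega>)) u
      = char (distr M borel (\<lambda>\<omega>. \<Sum>i\<in>{k<..k+T}. X i \<omega>)) u"
    by (simp add: S_diff)
  also have "\<dots> = (\<Prod>i\<in>{k<..k+T}. char (distr M borel (X i)) u)"
    by (rule char_distr_sum) (auto intro: indep_vars_subset[OF indep])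
  also have "\<dots> = (\<Prod>i\<in>{k<..k+T}. char (distr M borel (X 1)) u)"
    by (rule prod.cong[OF refl], subst ident) auto
  finally show ?thesis by simp
qed

text \<open>
  The characteristic function of an increment over T steps is a T-th power. Its Gaussian average
  at width w receives, up to constants, w / sqrt T from the frequencies near 0, where the power decays like a Gaussian,
  and at most 1 / w^2 from the others, which Chebyshev's inequality makes rare.
\<close>
lemma concentration:
  "\<exists>C>0. \<forall>k T w. T \<ge> 1 \<longrightarrow> w > 0 \<longrightarrow>
    \<P>(\<omega> in M. \<bar>S (k + T) \<omega> - S k \<omega>\<bar> \<le> w) \<le> C * (w / sqrt T + 1 / w\<^sup>2)"
proof -
  let ?N = std_normal_distribution and ?\<phi> = "char (distr M borel (X 1))"
  interpret N: real_distribution ?N by (rule real_dist_normal_dist)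
  note [measurable] = X_measurable[of 1, OF order_refl]
  interpret D: real_distribution "distr M borel (X 1)" by (rule real_distribution_distr) measurable
  obtain \<delta> where \<delta>: "\<delta> > 0" and ch: "\<And>u. \<bar>u\<bar> \<le> \<delta> \<Longrightarrow> cmod (?\<phi> u) \<le> exp (- (\<sigma>\<^sup>2 / 4) * u\<^sup>2)"
    using char_near_zero by blast
  \<comment> \<open>The summand 2 / \<sigma> comes from the decay rate \<sigma>^2 / 4 near the frequency 0, the summand 1 / \<delta>^2
    from the frequencies g / w that exceed \<delta>.\<close>
  define C where "C = exp (1/2) * (2 / \<sigma> + 1 / \<delta>\<^sup>2)"
  have "\<P>(\<omega> in M. \<bar>S (k + T) \<omega> - S k \<omega>\<bar> \<le> w) \<le> C * (w / sqrt T + 1 / w\<^sup>2)"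
    if T: "T \<ge> 1" and w: "w > 0" for k T w
  proof -
    let ?\<nu> = "distr M borel (\<lambda>\<omega>. S (k + T) \<omega> - S k \<omega>)"
    define a where "a = \<sigma>\<^sup>2 / 4 * T / w\<^sup>2"
    have a: "a > 0" using \<sigma>_pos T w by (simp add: a_def)
    have rd: "real_distribution ?\<nu>" by (rule real_distribution_distr) measurable
    interpret V: real_distribution ?\<nu> by (rule rd)
    have "\<P>(\<omega> in M. \<bar>S (k + T) \<omega> - S k \<omega>\<bar> \<le> w) = measure ?\<nu> {x. \<bar>x\<bar> \<le> w}"
      by (subst measure_distr) (auto intro!: arg_cong[where f=prob])
    also have "\<dots> \<le> exp (1/2) * (LINT g|?N. cmod (char ?\<nu> (g / w)))"
      by (rule prob_small_le_char[OF rd w])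
    also have "(LINT g|?N. cmod (char ?\<nu> (g / w))) \<le> (LINT g|?N. exp (- a * g\<^sup>2) + g\<^sup>2 * (1 / (\<delta>\<^sup>2 * w\<^sup>2)))"
    proof (rule integral_mono)
      show "integrable ?N (\<lambda>g. cmod (char ?\<nu> (g / w)))"
        by (rule N.integrable_const_bound[where B=1]) (auto intro: V.cmod_char_le_1)
      have "integrable ?N (\<lambda>g. exp (- a * g\<^sup>2))"
        by (rule N.integrable_const_bound[where B=1]) (use a in auto)
      moreover have "integrable ?N (\<lambda>g. g\<^sup>2)" 
        by (rule integrable_std_normal_distribution_moment)
      ultimately show "integrable ?N (\<lambda>g. exp (- a * g\<^sup>2) + g\<^sup>2 * (1 / (\<delta>\<^sup>2 * w\<^sup>2)))" by auto
      fix g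
      \<comment> \<open>The first summand is a bound if g / w is at most \<delta>; otherwise the second one is at least 1.\<close>
      show "cmod (char ?\<nu> (g / w)) \<le> exp (- a * g\<^sup>2) + g\<^sup>2 * (1 / (\<delta>\<^sup>2 * w\<^sup>2))"
      proof (cases "\<bar>g / w\<bar> \<le> \<delta>")
        case True
        have "cmod (char ?\<nu> (g / w)) = cmod (?\<phi> (g / w)) ^ T"
          by (simp add: char_increment norm_power)
        also have "\<dots> \<le> exp (- (\<sigma>\<^sup>2 / 4) * (g / w)\<^sup>2) ^ T"
          by (intro power_mono ch True) auto
        also have "\<dots> = exp (real T * (- (\<sigma>\<^sup>2 / 4) * (g / w)\<^sup>2))"
          by (rule exp_of_nat_mult[symmetric])
        also have "real T * (- (\<sigma>\<^sup>2 / 4) * (g / w)\<^sup>2) = - a * g\<^sup>2"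
          by (simp add: a_def field_simps)
        finally show ?thesis by (smt (verit) divide_nonneg_nonneg mult_nonneg_nonneg zero_le_power2)
      next
        case False
        then have "\<delta> * w < \<bar>g\<bar>" using w by (simp add: field_simps)
        then have "(\<delta> * w)\<^sup>2 \<le> g\<^sup>2" using \<delta> w by (intro abs_le_square_iff[THEN iffD1]) auto
        then have "1 \<le> g\<^sup>2 * (1 / (\<delta>\<^sup>2 * w\<^sup>2))"
          using \<delta> w by (simp add: power_mult_distrib)
        then show ?thesis using V.cmod_char_le_1[of "g / w"] by (smt (verit) exp_ge_zero)
      qed
    qed
    also have "\<dots> = (LINT g|?N. exp (- a * g\<^sup>2)) + 1 / (\<delta>\<^sup>2 * w\<^sup>2)"
    proof (subst Bochner_Integration.integral_add)
      show "integrable ?N (\<lambda>g. exp (- a * g\<^sup>2))"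
        by (rule N.integrable_const_bound[where B=1]) (use a in auto)
      show "integrable ?N (\<lambda>g. g\<^sup>2 * (1 / (\<delta>\<^sup>2 * w\<^sup>2)))"
        using integrable_std_normal_distribution_moment[of 2] by auto
      show "(LINT g|?N. exp (- a * g\<^sup>2)) + (LINT g|?N. g\<^sup>2 * (1 / (\<delta>\<^sup>2 * w\<^sup>2)))
        = (LINT g|?N. exp (- a * g\<^sup>2)) + 1 / (\<delta>\<^sup>2 * w\<^sup>2)"
        using std_normal_distribution_even_moments(1)[of 1] by simp
    qed
    also have "\<dots> \<le> 1 / sqrt (2 * a) + 1 / (\<delta>\<^sup>2 * w\<^sup>2)"
      using gauss_exp_square_le[OF a] by simp
    also have "1 / sqrt (2 * a) \<le> 1 / sqrt a"
      using a by (intro divide_left_mono) auto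
    also have "1 / sqrt a = 2 / \<sigma> * (w / sqrt T)"
      using \<sigma>_pos w by (simp add: a_def real_sqrt_divide real_sqrt_mult)
    also have "exp (1/2) * (2 / \<sigma> * (w / sqrt T) + 1 / (\<delta>\<^sup>2 * w\<^sup>2))
        \<le> exp (1/2) * ((2 / \<sigma> + 1 / \<delta>\<^sup>2) * (w / sqrt T + 1 / w\<^sup>2))"
    proof (rule mult_left_mono)
      have "(2 / \<sigma> + 1 / \<delta>\<^sup>2) * (w / sqrt T + 1 / w\<^sup>2) = (2 / \<sigma> * (w / sqrt T) + 1 / (\<delta>\<^sup>2 * w\<^sup>2))
        + (2 / \<sigma> * (1 / w\<^sup>2) + 1 / \<delta>\<^sup>2 * (w / sqrt T))" by (simp add: algebra_simps)
      moreover have "0 \<le> 2 / \<sigma> * (1 / w\<^sup>2) + 1 / \<delta>\<^sup>2 * (w / sqrt T)" using \<sigma>_pos w by simp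
      ultimately show "2 / \<sigma> * (w / sqrt T) + 1 / (\<delta>\<^sup>2 * w\<^sup>2) \<le> (2 / \<sigma> + 1 / \<delta>\<^sup>2) * (w / sqrt T + 1 / w\<^sup>2)"
        by linarith
    qed simp
    finally show ?thesis by (simp add: C_def algebra_simps)
  qed
  moreover have "C > 0" using \<sigma>_pos \<delta> by (simp add: C_def add_pos_nonneg)
  ultimately show ?thesis by blast
qed

end

section \<open>Visits to a level\<close>

lemma pred_abs_le:
  "f \<in> borel_measurable N \<Longrightarrow> Measurable.pred N (\<lambda>\<omega>. \<bar>f \<omega>\<bar> \<le> (c :: real))"
  by measurable

lemma pred_card_ge:
  assumes "finite A" "\<And>q. q \<in> A \<Longrightarrow> Measurable.pred N (P q)"
  shows "Measurable.pred N (\<lambda>\<omega>. b \<le> card {q\<in>A. P q \<omega>})"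
proof -
  have "b \<le> card {q\<in>A. P q \<omega>} \<longleftrightarrow> (\<exists>W\<in>{W\<in>Pow A. b \<le> card W}. \<forall>q\<in>W. P q \<omega>)" for \<omega>
  proof
    assume "\<exists>W\<in>{W\<in>Pow A. b \<le> card W}. \<forall>q\<in>W. P q \<omega>"
    then obtain W where "W \<subseteq> {q\<in>A. P q \<omega>}" "b \<le> card W" by blast
    then show "b \<le> card {q\<in>A. P q \<omega>}"
      using card_mono[of "{q\<in>A. P q \<omega>}" W] assms(1) by auto
  next
    assume "b \<le> card {q\<in>A. P q \<omega>}"
    then show "\<exists>W\<in>{W\<in>Pow A. b \<le> card W}. \<forall>q\<in>W. P q \<omega>"
      by (intro bexI[of _ "{q\<in>A. P q \<omega>}"]) auto
  qed
  moreover have "Measurable.pred N (\<lambda>\<omega>. \<exists>W\<in>{W\<in>Pow A. b \<le> card W}. \<forall>q\<in>W. P q \<omega>)"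
    using assms by (intro pred_intros_finite) (auto intro: finite_subset)
  ultimately show ?thesis by simp
qed

text \<open>
  Markov's inequality for the number of events that occur.
\<close>
lemma (in prob_space) prob_card_ge_le:
  assumes A: "finite A" and P: "\<And>q. q \<in> A \<Longrightarrow> Measurable.pred M (P q)" and b: "b > 0"
  shows "\<P>(\<omega> in M. b \<le> card {q\<in>A. P q \<omega>}) \<le> (\<Sum>q\<in>A. \<P>(\<omega> in M. P q \<omega>)) / b"
proof -
  have c: "real (card {q\<in>A. P q \<omega>}) = (\<Sum>q\<in>A. indicator {\<omega>\<in>space M. P q \<omega>} \<omega>)" if "\<omega> \<in> space M" for \<omega>
    using A that by (simp add: indicator_def sum.If_cases Int_def)
  have ev: "{\<omega>\<in>space M. P q \<omega>} \<in> events" if "q \<in> A" for q using P[OF that] by simp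
  have "\<P>(\<omega> in M. b \<le> card {q\<in>A. P q \<omega>})
      = \<P>(\<omega> in M. real b \<le> (\<Sum>q\<in>A. indicator {\<omega>\<in>space M. P q \<omega>} \<omega>))"
    by (rule arg_cong[where f=prob]) (auto simp flip: c)
  also have "\<dots> \<le> (\<integral>\<omega>. (\<Sum>q\<in>A. indicator {\<omega>\<in>space M. P q \<omega>} \<omega>) \<partial>M) / b"
    using ev b by (intro integral_Markov_inequality_measure[where A="{}"])
      (auto intro!: sum_nonneg Bochner_Integration.integrable_sum simp: emeasure_eq_measure)
  also have "(\<integral>\<omega>. (\<Sum>q\<in>A. indicator {\<omega>\<in>space M. P q \<omega>} \<omega>) \<partial>M) = (\<Sum>q\<in>A. \<P>(\<omega> in M. P q \<omega>))"
    using ev by (subst Bochner_Integration.integral_sum) (auto simp: emeasure_eq_measure Int_absorb1 sets.sets_into_space)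
  finally show ?thesis .
qed

lemma sum_inverse_sqrt_le: "(\<Sum>d=1..n. 1 / sqrt (real d)) \<le> 2 * sqrt n"
proof (induction n)
  case (Suc n)
  have "1 / sqrt (real (Suc n)) \<le> 2 * (sqrt (Suc n) - sqrt n)"
  proof -
    have "(sqrt (Suc n) - sqrt n) * (sqrt (Suc n) + sqrt n) = 1"
      by (simp add: algebra_simps)
    moreover have "sqrt n \<le> sqrt (Suc n)" by simp
    ultimately have "1 \<le> (sqrt (Suc n) - sqrt n) * (2 * sqrt (Suc n))"
      by (smt (verit) mult_left_mono)
    then show ?thesis by (simp add: field_simps)
  qed
  then show ?case using Suc by simp
qed simp

context random_walk
begin

lemma prob_increment_small:
  assumes "k \<le> u" "x > 0" "4 * \<sigma>\<^sup>2 * real (u - k) \<le> x\<^sup>2"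
  shows "3/4 \<le> \<P>(\<omega> in M. \<bar>S u \<omega> - S k \<omega>\<bar> < x)"
proof -
  have "\<P>(\<omega> in M. \<not> \<bar>S u \<omega> - S k \<omega>\<bar> < x) = 1 - \<P>(\<omega> in M. \<bar>S u \<omega> - S k \<omega>\<bar> < x)"
    by (rule prob_neg) measurable
  moreover have "\<P>(\<omega> in M. \<not> \<bar>S u \<omega> - S k \<omega>\<bar> < x) \<le> 1/4"
  proof -
    have "\<sigma>\<^sup>2 * real (u - k) / x\<^sup>2 \<le> 1/4" using assms by (simp add: field_simps)
    then have "\<P>(\<omega> in M. \<bar>S u \<omega> - S k \<omega>\<bar> \<ge> x) \<le> 1/4" using chebyshev[OF assms(1,2)] by linarith
    then show ?thesis by (simp only: not_less)
  qed
  ultimately show ?thesis by linarith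
qed

text \<open>
  After its first visit to the band in the block, the walk moves by less than 2 \<sigma> sqrt m until the end
  of the block with probability at least 3/4. A visit at some time in the block is thus hardly more
  likely than a position in a slightly wider band at the one time e.
\<close>
lemma prob_block_hit_le:
  assumes "e - a \<le> m" "m \<ge> 1" "k \<le> a"
  shows "3/4 * \<P>(\<omega> in M. \<exists>t\<in>{a..<e}. \<bar>S t \<omega> - S k \<omega>\<bar> \<le> w)
    \<le> \<P>(\<omega> in M. \<bar>S e \<omega> - S k \<omega>\<bar> \<le> w + 2 * \<sigma> * sqrt m)"
proof -
  let ?E = "\<lambda>t \<omega>. a \<le> t \<and> \<bar>S t \<omega> - S k \<omega>\<bar> \<le> w"
  \<comment> \<open>No visit occurs before time a; there the condition on the future is made vacuous, since the walk
    may move far between t and e.\<close>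
  let ?G = "\<lambda>t \<omega>. a \<le> t \<longrightarrow> \<bar>S e \<omega> - S t \<omega>\<bar> < 2 * \<sigma> * sqrt m"
  have "3/4 * \<P>(\<omega> in M. \<exists>t<e. ?E t \<omega>) \<le> \<P>(\<omega> in M. \<bar>S e \<omega> - S k \<omega>\<bar> \<le> w + 2 * \<sigma> * sqrt m)"
  proof (rule prob_first_passage_ge)
    fix t assume t: "t < e"
    show "Measurable.pred (hist {1..t}) (?E t)"
    proof (cases "a \<le> t")
      case True
      then have [measurable]: "S t \<in> borel_measurable (hist {1..t})" "S k \<in> borel_measurable (hist {1..t})"
        using assms(3) S_past[of t t] S_past[of k t] by simp_all
      show ?thesis by measurable
    qed simp
    have [measurable]: "(\<lambda>\<omega>. S e \<omega> - S t \<omega>) \<in> borel_measurable (hist {t<..})"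
      using t by (intro S_future) auto
    show "Measurable.pred (hist {t<..}) (?G t)" by measurable
    show "3/4 \<le> \<P>(\<omega> in M. ?G t \<omega>)"
    proof (cases "a \<le> t")
      case True
      have "4 * \<sigma>\<^sup>2 * real (e - t) \<le> 4 * \<sigma>\<^sup>2 * real m"
        using True assms t by (intro mult_left_mono) auto
      also have "\<dots> = (2 * \<sigma> * sqrt m)\<^sup>2" by (simp add: power_mult_distrib)
      finally show ?thesis
        using prob_increment_small[of t e "2 * \<sigma> * sqrt m"] True t \<sigma>_pos assms by simp
    qed (simp add: prob_space)
  qed auto
  moreover have "(\<exists>t<e. ?E t \<omega>) \<longleftrightarrow> (\<exists>t\<in>{a..<e}. \<bar>S t \<omega> - S k \<omega>\<bar> \<le> w)" for \<omega> by auto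
  ultimately show ?thesis by simp
qed

text \<open>
  The blocks of length m are counted from time k, while the level is the position at time \<tau>. The two
  times differ when the walk is restarted at \<tau> inside the grid of blocks that was fixed at time k.
\<close>
definition hit :: "nat \<Rightarrow> nat \<Rightarrow> nat \<Rightarrow> real \<Rightarrow> nat \<Rightarrow> 'a \<Rightarrow> bool" where
  "hit k m \<tau> w q \<omega> \<longleftrightarrow> (\<exists>t\<in>{k + q * m..<k + Suc q * m}. \<bar>S t \<omega> - S \<tau> \<omega>\<bar> \<le> w)"

lemma hit_measurable: "Measurable.pred M (hit k m \<tau> w q)"
  unfolding hit_def by measurable

text \<open>
  If \<tau> lies in or before block p, a later block q is visited with probability
  O(1 / sqrt (q - p) + 1 / m). The first terms add up to O(K) over K^2 blocks, and so do the second ones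
  because K is at most m. Markov's inequality does the rest.
\<close>
lemma later_hits_rare:
  "\<exists>B\<ge>1. \<forall>k m K p \<tau>. 1 \<le> K \<longrightarrow> K \<le> m \<longrightarrow> \<tau> < k + Suc p * m \<longrightarrow>
     \<P>(\<omega> in M. B * K \<le> card {q\<in>{p<..<K\<^sup>2}. hit k m \<tau> (2 * sqrt m) q \<omega>}) \<le> 1/2"
proof -
  obtain C where C: "C > 0" and conc: "\<And>k T w. T \<ge> 1 \<Longrightarrow> w > 0 \<Longrightarrow>
    \<P>(\<omega> in M. \<bar>S (k + T) \<omega> - S k \<omega>\<bar> \<le> w) \<le> C * (w / sqrt T + 1 / w\<^sup>2)"
    using concentration by auto
  \<comment> \<open>The radius 2 sqrt m of the band, enlarged by the 2 \<sigma> sqrt m that the walk may move within a block.\<close>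
  define \<kappa> where "\<kappa> = 2 + 2 * \<sigma>"
  define D where "D = 4/3 * C * (\<kappa> + 1)"
  have k2: "\<kappa> \<ge> 2" using \<sigma>_pos by (simp add: \<kappa>_def)
  define B where "B = Suc (nat \<lceil>6 * D\<rceil>)"
  have D: "D > 0" using C k2 by (simp add: D_def)
  have B: "real B \<ge> 6 * D" "B \<ge> 1" unfolding B_def using real_nat_ceiling_ge[of "6 * D"] by simp_all
  have "\<P>(\<omega> in M. B * K \<le> card {q\<in>{p<..<K\<^sup>2}. hit k m \<tau> (2 * sqrt m) q \<omega>}) \<le> 1/2"
    if K: "1 \<le> K" "K \<le> m" and \<tau>: "\<tau> < k + Suc p * m" for k m K p \<tau>
  proof -
    have m: "m \<ge> 1" using K by simp
    have one: "\<P>(\<omega> in M. hit k m \<tau> (2 * sqrt m) q \<omega>) \<le> D * (1 / sqrt (q - p) + 1 / m)"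
      if q: "p < q" for q
    proof -
      let ?e = "k + Suc q * m"
      have sp: "Suc p * m \<le> q * m" using q by (intro mult_le_mono1) simp
      have "\<tau> \<le> ?e" using \<tau> sp by simp
      then obtain T where T: "?e = \<tau> + T" using le_Suc_ex by blast
      have "(q - p) * m = Suc q * m - Suc p * m" by (simp add: diff_mult_distrib)
      then have Tm: "(q - p) * m \<le> T" using T \<tau> by simp
      have Tm': "real (q - p) * m \<le> T" using of_nat_mono[OF Tm, where ?'a=real] by simp
      have pos: "0 < real (q - p) * m" using q m by simp
      have "0 < real T" using pos Tm' by linarith
      then have T1: "T \<ge> 1" by simp
      have "3/4 * \<P>(\<omega> in M. hit k m \<tau> (2 * sqrt m) q \<omega>)
         \<le> \<P>(\<omega> in M. \<bar>S ?e \<omega> - S \<tau> \<omega>\<bar> \<le> 2 * sqrt m + 2 * \<sigma> * sqrt m)"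
        unfolding hit_def by (rule prob_block_hit_le) (use m \<tau> sp in auto)
      also have "2 * sqrt m + 2 * \<sigma> * sqrt m = \<kappa> * sqrt m" by (simp add: \<kappa>_def algebra_simps)
      also have "\<P>(\<omega> in M. \<bar>S ?e \<omega> - S \<tau> \<omega>\<bar> \<le> \<kappa> * sqrt m)
         \<le> C * (\<kappa> * sqrt m / sqrt T + 1 / (\<kappa> * sqrt m)\<^sup>2)"
        unfolding T using k2 m by (intro conc T1) auto
      also have "\<dots> \<le> C * (\<kappa> * (1 / sqrt (q - p)) + 1 / m)"
      proof (intro mult_left_mono add_mono)
        have "\<kappa> * sqrt m / sqrt T \<le> \<kappa> * sqrt m / sqrt (real (q - p) * m)"
        proof (intro divide_left_mono)
          show "sqrt (real (q - p) * m) \<le> sqrt T" using Tm' by (simp only: real_sqrt_le_iff)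
          show "0 < sqrt T * sqrt (real (q - p) * m)"
          proof (rule mult_pos_pos)
            show "0 < sqrt (real (q - p) * m)" using pos by (simp only: real_sqrt_gt_0_iff)
          qed (use T1 in simp)
        qed (use k2 in simp)
        then show "\<kappa> * sqrt m / sqrt T \<le> \<kappa> * (1 / sqrt (q - p))"
          using m by (simp add: real_sqrt_mult)
        have "(\<kappa> * sqrt m)\<^sup>2 = \<kappa>\<^sup>2 * m" by (simp add: power_mult_distrib)
        moreover have "1 \<le> \<kappa>\<^sup>2" using k2 by (intro one_le_power) simp
        then have "1 * real m \<le> \<kappa>\<^sup>2 * m" by (intro mult_right_mono) auto
        ultimately show "1 / (\<kappa> * sqrt m)\<^sup>2 \<le> 1 / m" using m by (simp add: divide_simps)
      qed (use C in auto)
      also have "\<dots> \<le> C * ((\<kappa> + 1) * (1 / sqrt (q - p) + 1 / m))"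
      proof (rule mult_left_mono)
        have "0 \<le> \<kappa> * (1 / real m) + 1 / sqrt (q - p)" using k2 q by simp
        then show "\<kappa> * (1 / sqrt (q - p)) + 1 / m \<le> (\<kappa> + 1) * (1 / sqrt (q - p) + 1 / m)"
          unfolding distrib_left distrib_right by linarith
      qed (use C in simp)
      finally have "\<P>(\<omega> in M. hit k m \<tau> (2 * sqrt m) q \<omega>)
        \<le> 4/3 * (C * ((\<kappa> + 1) * (1 / sqrt (q - p) + 1 / m)))" by linarith
      then show ?thesis by (simp only: D_def mult.assoc)
    qed
    have "(\<Sum>q\<in>{p<..<K\<^sup>2}. \<P>(\<omega> in M. hit k m \<tau> (2 * sqrt m) q \<omega>))
        \<le> (\<Sum>q\<in>{p<..<K\<^sup>2}. D * (1 / sqrt (q - p) + 1 / m))"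
      by (intro sum_mono one) auto
    also have "\<dots> = (\<Sum>d\<in>{0<..<K\<^sup>2 - p}. D * (1 / sqrt d + 1 / m))"
      by (rule sum.reindex_bij_witness[of _ "\<lambda>d. d + p" "\<lambda>q. q - p"]) auto
    also have "\<dots> \<le> (\<Sum>d=1..K\<^sup>2. D * (1 / sqrt d + 1 / m))"
      using D by (intro sum_mono2) auto
    also have "\<dots> = D * ((\<Sum>d=1..K\<^sup>2. 1 / sqrt d) + real (K\<^sup>2) / m)"
      by (simp add: sum_distrib_left[symmetric] sum.distrib)
    also have "\<dots> \<le> D * (2 * real K + real K)"
    proof (intro mult_left_mono add_mono)
      show "(\<Sum>d=1..K\<^sup>2. 1 / sqrt d) \<le> 2 * real K" using sum_inverse_sqrt_le[of "K\<^sup>2"] by simp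
      have "real K * K \<le> real K * m" using K by (intro mult_left_mono) auto
      then show "real (K\<^sup>2) / m \<le> K" using m by (simp add: field_simps power2_eq_square)
    qed (use D in auto)
    also have "\<dots> \<le> real (B * K) / 2"
      using mult_right_mono[OF B(1), of "real K"] by simp
    finally have sum: "(\<Sum>q\<in>{p<..<K\<^sup>2}. \<P>(\<omega> in M. hit k m \<tau> (2 * sqrt m) q \<omega>)) \<le> real (B * K) / 2" .
    have pos: "B * K > 0" using B K by simp
    have "\<P>(\<omega> in M. B * K \<le> card {q\<in>{p<..<K\<^sup>2}. hit k m \<tau> (2 * sqrt m) q \<omega>})
      \<le> (\<Sum>q\<in>{p<..<K\<^sup>2}. \<P>(\<omega> in M. hit k m \<tau> (2 * sqrt m) q \<omega>)) / (B * K)"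
      by (rule prob_card_ge_le) (use pos hit_measurable in auto)
    also have "\<dots> \<le> real (B * K) / 2 / (B * K)"
      using sum by (intro divide_right_mono) auto
    also have "\<dots> = 1/2" using pos by simp
    finally show ?thesis .
  qed
  then show ?thesis using B(2) by blast
qed

text \<open>
  The number of visited blocks has a geometric tail. Consider the first time t at which
  s * B * K + 1 blocks have been visited. The walk is then within sqrt m of S k, so each further visit
  to the band around S k is a visit to the band of twice the radius around S t. By the previous lemma,
  B * K such visits in later blocks have probability at most 1/2, independently of the past of t.
  The block that starts at time k is always visited, which is the reason for the strict inequality.
\<close>
lemma level_hits_tail:
  "\<exists>B\<ge>1. \<forall>k m K s. 1 \<le> K \<longrightarrow> K \<le> m \<longrightarrow>
     \<P>(\<omega> in M. s * (B * K) < card {q\<in>{..<K\<^sup>2}. hit k m k (sqrt m) q \<omega>}) \<le> (1/2) ^ s"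
proof -
  obtain B where B: "B \<ge> 1" and later: "\<And>k m K p \<tau>. 1 \<le> K \<Longrightarrow> K \<le> m \<Longrightarrow> \<tau> < k + Suc p * m \<Longrightarrow>
     \<P>(\<omega> in M. B * K \<le> card {q\<in>{p<..<K\<^sup>2}. hit k m \<tau> (2 * sqrt m) q \<omega>}) \<le> 1/2"
    using later_hits_rare by blast
  have "\<P>(\<omega> in M. s * (B * K) < card {q\<in>{..<K\<^sup>2}. hit k m k (sqrt m) q \<omega>}) \<le> (1/2) ^ s"
    if K: "1 \<le> K" "K \<le> m" for k m K s
  proof (induction s)
    case 0
    then show ?case by simp
  next
    case (Suc s)
    have m: "m \<ge> 1" using K by simp
    let ?b = "B * K" and ?T = "k + K\<^sup>2 * m"
    \<comment> \<open>The blocks that are visited no later than time t.\<close>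
    define A where "A t \<omega> = {q\<in>{..<K\<^sup>2}. \<exists>u\<in>{k + q * m..<k + Suc q * m} \<inter> {..t}. \<bar>S u \<omega> - S k \<omega>\<bar> \<le> sqrt m}" for t \<omega>
    let ?E = "\<lambda>t \<omega>. k \<le> t \<and> Suc (s * ?b) \<le> card (A t \<omega>)"
    let ?p = "\<lambda>t. (t - k) div m"
    let ?G = "\<lambda>t \<omega>. k \<le> t \<and> ?b \<le> card {q\<in>{?p t<..<K\<^sup>2}. hit k m t (2 * sqrt m) q \<omega>}"
    \<comment> \<open>?p u is the index of the block that contains u.\<close>
    have block: "u < k + Suc (?p u) * m" "k \<le> u \<Longrightarrow> k + ?p u * m \<le> u" for u
    proof -
      define p where "p = ?p u"
      have "u - k < m + p * m" using m dividend_less_div_times[of m "u - k"] by (simp add: p_def add.commute)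
      moreover have "p * m \<le> u - k" unfolding p_def by (rule div_times_less_eq_dividend)
      ultimately have "u < k + Suc p * m" "k \<le> u \<Longrightarrow> k + p * m \<le> u" by auto
      then show "u < k + Suc (?p u) * m" "k \<le> u \<Longrightarrow> k + ?p u * m \<le> u" by (simp_all only: p_def)
    qed
    have uniq: "q = ?p u" if "u \<in> {k + q * m..<k + Suc q * m}" for u q
    proof -
      have "m * q \<le> u - k" "u - k < m * Suc q" using that by (auto simp: mult.commute)
      then show ?thesis by (rule div_nat_eqI[symmetric])
    qed
    have fin: "finite (A t \<omega>)" for t \<omega> by (simp add: A_def)
    have "\<P>(\<omega> in M. Suc s * ?b < card {q\<in>{..<K\<^sup>2}. hit k m k (sqrt m) q \<omega>})
      \<le> 1/2 * \<P>(\<omega> in M. \<exists>t<?T. ?E t \<omega>)"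
    proof (rule prob_first_passage_le[where G="?G"])
      fix t assume t: "t < ?T"
      show "Measurable.pred (hist {1..t}) (?E t)"
      proof (cases "k \<le> t")
        case True
        have [measurable]: "S k \<in> borel_measurable (hist {1..t})" using True by (rule S_past)
        have "Measurable.pred (hist {1..t}) (\<lambda>\<omega>. Suc (s * ?b) \<le> card (A t \<omega>))"
          unfolding A_def
        proof (rule pred_card_ge)
          fix q
          have "Measurable.pred (hist {1..t}) (\<lambda>\<omega>. \<bar>S u \<omega> - S k \<omega>\<bar> \<le> sqrt m)" if "u \<le> t" for u
          proof -
            have [measurable]: "S u \<in> borel_measurable (hist {1..t})" using that by (rule S_past)
            show ?thesis by measurable
          qed
          then show "Measurable.pred (hist {1..t})
            (\<lambda>\<omega>. \<exists>u\<in>{k + q * m..<k + Suc q * m} \<inter> {..t}. \<bar>S u \<omega> - S k \<omega>\<bar> \<le> sqrt m)"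
            by (intro pred_intros_finite(4)) auto
        qed simp
        then show ?thesis by (simp only: True simp_thms)
      qed simp
      show "Measurable.pred (hist {t<..}) (?G t)"
      proof (cases "k \<le> t")
        case True
        have "Measurable.pred (hist {t<..}) (\<lambda>\<omega>. ?b \<le> card {q\<in>{?p t<..<K\<^sup>2}. hit k m t (2 * sqrt m) q \<omega>})"
        proof (rule pred_card_ge)
          fix q assume q: "q \<in> {?p t<..<K\<^sup>2}"
          from q have "Suc (?p t) \<le> q" by (simp only: greaterThanLessThan_iff Suc_le_eq)
          then have qm: "Suc (?p t) * m \<le> q * m" by (rule mult_le_mono1)
          have "Measurable.pred (hist {t<..}) (\<lambda>\<omega>. \<bar>S u \<omega> - S t \<omega>\<bar> \<le> 2 * sqrt m)"
            if "k + q * m \<le> u" for u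
          proof -
            have "t < k + q * m" using block(1)[of t] add_left_mono[OF qm, of k] by (rule less_le_trans)
            then have "t \<le> u" using that by simp
            then show ?thesis by (intro pred_abs_le S_future)
          qed
          then have "Measurable.pred (hist {t<..})
            (\<lambda>\<omega>. \<exists>u\<in>{k + q * m..<k + Suc q * m}. \<bar>S u \<omega> - S t \<omega>\<bar> \<le> 2 * sqrt m)"
            by (rule pred_intros_finite(4)[rotated]) (simp_all only: atLeastLessThan_iff finite_atLeastLessThan)
          then show "Measurable.pred (hist {t<..}) (hit k m t (2 * sqrt m) q)"
            by (simp only: hit_def[abs_def])
        qed simp
        then show ?thesis by (simp only: True simp_thms)
      qed simp
      show "\<P>(\<omega> in M. ?G t \<omega>) \<le> 1/2"
        using later[of K m t k "?p t", OF K block(1)] by (cases "k \<le> t") simp_all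
    next
      fix \<omega> assume "\<omega> \<in> space M" and big: "Suc s * ?b < card {q\<in>{..<K\<^sup>2}. hit k m k (sqrt m) q \<omega>}"
      have m0: "0 < K\<^sup>2 * m" using K m by simp
      have "{q\<in>{..<K\<^sup>2}. hit k m k (sqrt m) q \<omega>} \<subseteq> A (?T - 1) \<omega>"
      proof
        fix q assume "q \<in> {q\<in>{..<K\<^sup>2}. hit k m k (sqrt m) q \<omega>}"
        then obtain u where q: "q < K\<^sup>2" and u: "u \<in> {k + q * m..<k + Suc q * m}" "\<bar>S u \<omega> - S k \<omega>\<bar> \<le> sqrt m"
          by (auto simp: hit_def)
        have "Suc q * m \<le> K\<^sup>2 * m" using q by (intro mult_le_mono1) simp
        then have "u \<le> ?T - 1" using u(1) by auto
        then show "q \<in> A (?T - 1) \<omega>" using q u by (auto simp: A_def)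
      qed
      then have "card {q\<in>{..<K\<^sup>2}. hit k m k (sqrt m) q \<omega>} \<le> card (A (?T - 1) \<omega>)"
        by (rule card_mono[OF fin])
      moreover have "k \<le> ?T - 1" using m0 by linarith
      ultimately have "?E (?T - 1) \<omega>" using big by simp
      then obtain t where t: "t < ?T" "first ?E t \<omega>"
        using ex_first[of "?T - 1" ?T ?E \<omega>] m0 by auto
      then have kt: "k \<le> t" and At: "Suc (s * ?b) \<le> card (A t \<omega>)"
        and before: "\<And>u. u < t \<Longrightarrow> k \<le> u \<Longrightarrow> card (A u \<omega>) \<le> s * ?b"
        by (auto simp: first_def not_le less_Suc_eq_le not_less_eq_eq)
      have old: "k < t \<and> q \<in> A (t - 1) \<omega>" if "u < t" "u \<in> {k + q * m..<k + Suc q * m}" "q < K\<^sup>2"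
          "\<bar>S u \<omega> - S k \<omega>\<bar> \<le> sqrt m" for u q
      proof
        show "k < t" using that by auto
        have "u \<le> t - 1" using that(1) by simp
        then show "q \<in> A (t - 1) \<omega>" using that by (auto simp: A_def)
      qed
      have prev: "card (A (t - 1) \<omega>) \<le> s * ?b" if "k < t" using before[of "t - 1"] that by simp
      \<comment> \<open>The number of visited blocks grows by at most one per time step, so it has no overshoot at t.\<close>
      have At_le: "card (A t \<omega>) \<le> Suc (s * ?b)"
      proof (cases "k < t")
        case True
        have "A t \<omega> \<subseteq> insert (?p t) (A (t - 1) \<omega>)"
        proof
          fix q assume "q \<in> A t \<omega>"
          then obtain u where u: "u \<in> {k + q * m..<k + Suc q * m}" "u \<le> t" "q < K\<^sup>2"
            "\<bar>S u \<omega> - S k \<omega>\<bar> \<le> sqrt m" by (auto simp: A_def)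
          then show "q \<in> insert (?p t) (A (t - 1) \<omega>)"
            using old[of u q] uniq[of u q] by (cases "u = t") auto
        qed
        then have "card (A t \<omega>) \<le> card (insert (?p t) (A (t - 1) \<omega>))" by (intro card_mono) (simp_all add: fin)
        also have "\<dots> \<le> Suc (card (A (t - 1) \<omega>))" by (rule card_insert_le_m1) simp_all
        finally show ?thesis using prev[OF True] by linarith
      next
        case False
        have "A t \<omega> \<subseteq> {?p t}"
        proof
          fix q assume "q \<in> A t \<omega>"
          then obtain u where u: "u \<in> {k + q * m..<k + Suc q * m}" "u \<le> t" by (auto simp: A_def)
          then have "u = t" using False kt by auto
          then show "q \<in> {?p t}" using uniq[OF u(1)] by simp
        qed
        then have "card (A t \<omega>) \<le> card {?p t}" by (rule card_mono[rotated]) simp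
        then show ?thesis by simp
      qed
      \<comment> \<open>A time at which the number of visited blocks grows is itself a time of a visit.\<close>
      have near: "\<bar>S t \<omega> - S k \<omega>\<bar> \<le> sqrt m"
      proof (rule ccontr)
        assume far: "\<not> \<bar>S t \<omega> - S k \<omega>\<bar> \<le> sqrt m"
        then have "t \<noteq> k" by auto
        then have "k < t" using kt by simp
        have "A t \<omega> \<subseteq> A (t - 1) \<omega>"
        proof
          fix q assume "q \<in> A t \<omega>"
          then obtain u where u: "u \<in> {k + q * m..<k + Suc q * m}" "u \<le> t" "q < K\<^sup>2"
            "\<bar>S u \<omega> - S k \<omega>\<bar> \<le> sqrt m" by (auto simp: A_def)
          then have "u \<noteq> t" using far by auto
          then show "q \<in> A (t - 1) \<omega>" using old[of u q] u by auto
        qed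
        then have "card (A t \<omega>) \<le> card (A (t - 1) \<omega>)" by (rule card_mono[OF fin])
        then show False using prev[OF \<open>k < t\<close>] At by linarith
      qed
      let ?L = "{q\<in>{?p t<..<K\<^sup>2}. hit k m t (2 * sqrt m) q \<omega>}"
      have "{q\<in>{..<K\<^sup>2}. hit k m k (sqrt m) q \<omega>} \<subseteq> A t \<omega> \<union> ?L"
      proof
        fix q assume "q \<in> {q\<in>{..<K\<^sup>2}. hit k m k (sqrt m) q \<omega>}"
        then obtain u where q: "q < K\<^sup>2" and u: "u \<in> {k + q * m..<k + Suc q * m}" "\<bar>S u \<omega> - S k \<omega>\<bar> \<le> sqrt m"
          by (auto simp: hit_def)
        consider "q < ?p t" | "q = ?p t" | "?p t < q" by linarith
        then show "q \<in> A t \<omega> \<union> ?L"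
        proof cases
          case 1
          have "u \<le> t"
          proof (rule ccontr)
            assume "\<not> u \<le> t"
            then have "?p t \<le> ?p u" by (intro div_le_mono) simp
            then show False using 1 uniq[OF u(1)] by simp
          qed
          then show ?thesis using q u by (auto simp: A_def)
        next
          case 2
          then have "t \<in> {k + q * m..<k + Suc q * m}" using block[of t] kt by simp
          then show ?thesis using q near unfolding A_def by blast
        next
          case 3
          have "\<bar>S u \<omega> - S t \<omega>\<bar> \<le> 2 * sqrt m" using u(2) near by linarith
          then show ?thesis using 3 q u(1) unfolding hit_def by auto
        qed
      qed
      then have "card {q\<in>{..<K\<^sup>2}. hit k m k (sqrt m) q \<omega>} \<le> card (A t \<omega> \<union> ?L)"
        by (intro card_mono) (simp_all add: fin)
      also have "\<dots> \<le> card (A t \<omega>) + card ?L" by (rule card_Un_le)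
      finally have "?b \<le> card ?L" using big At_le by simp
      then show "\<exists>t<?T. first ?E t \<omega> \<and> ?G t \<omega>" using t kt by (intro exI[of _ t]) simp
    qed
    also have "\<P>(\<omega> in M. \<exists>t<?T. ?E t \<omega>) \<le> \<P>(\<omega> in M. s * ?b < card {q\<in>{..<K\<^sup>2}. hit k m k (sqrt m) q \<omega>})"
    proof (rule finite_measure_mono)
      have le: "card (A t \<omega>) \<le> card {q\<in>{..<K\<^sup>2}. hit k m k (sqrt m) q \<omega>}" for t \<omega>
        by (rule card_mono) (auto simp: A_def hit_def)
      then have "s * ?b < card {q\<in>{..<K\<^sup>2}. hit k m k (sqrt m) q \<omega>}" if "?E t \<omega>" for t \<omega>
        using that le[of t \<omega>] by linarith
      then show "{\<omega>\<in>space M. \<exists>t<?T. ?E t \<omega>} \<subseteq> {\<omega>\<in>space M. s * ?b < card {q\<in>{..<K\<^sup>2}. hit k m k (sqrt m) q \<omega>}}"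
        by blast
      show "{\<omega>\<in>space M. s * ?b < card {q\<in>{..<K\<^sup>2}. hit k m k (sqrt m) q \<omega>}} \<in> events"
        using pred_card_ge[where N=M and A="{..<K\<^sup>2}" and P="hit k m k (sqrt m)" and b="Suc (s * ?b)"]
          hit_measurable
        by (simp only: Suc_le_eq pred_def finite_lessThan simp_thms)
    qed
    also note Suc.IH
    finally show ?case by simp
  qed
  then show ?thesis using B by blast
qed

end

section \<open>Increasing sets along a path that rarely returns to its levels\<close>

text \<open>
  Because f is increasing on A, the ranges of f on the parts of A in successive blocks do not overlap.
  A bound that is linear in the height of the range therefore pays for the height only once, and for
  the constant term once per block that A meets.
\<close>
lemma card_le_blocks:
  fixes f :: "nat \<Rightarrow> real" and \<alpha> \<beta> :: real
  assumes bound: "\<And>A lo x y. A \<subseteq> W \<Longrightarrow> A \<subseteq> {lo..<lo + m} \<Longrightarrow> mono_on A f \<Longrightarrow> f ` A \<subseteq> {x..y} \<Longrightarrow> x \<le> y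
      \<Longrightarrow> real (card A) \<le> \<alpha> + \<beta> * (y - x)"
    and "0 \<le> \<alpha>" "0 \<le> \<beta>"
    and "A \<subseteq> W" "A \<subseteq> {k..<k + Q * m}" "mono_on A f" "f ` A \<subseteq> {x..y}" "x \<le> y"
  shows "real (card A) \<le> \<alpha> * card {q\<in>{..<Q}. A \<inter> {k + q * m..<k + Suc q * m} \<noteq> {}} + \<beta> * (y - x)"
  using assms(4-)
proof (induction Q arbitrary: A y)
  case 0
  then show ?case using \<open>0 \<le> \<beta>\<close> by simp
next
  case (Suc Q)
  let ?hits = "\<lambda>A Q. {q\<in>{..<Q}. A \<inter> {k + q * m..<k + Suc q * m} \<noteq> {}}"
  define A1 where "A1 = A \<inter> {..<k + Q * m}"
  define A2 where "A2 = A \<inter> {k + Q * m..}"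
  have finA: "finite A" using Suc.prems(2) by (rule finite_subset) simp
  have A12: "A = A1 \<union> A2" "A1 \<inter> A2 = {}" by (auto simp: A1_def A2_def)
  have A1: "A1 \<subseteq> W" "A1 \<subseteq> {k..<k + Q * m}" "mono_on A1 f"
    using Suc.prems by (auto simp: A1_def intro: mono_on_subset)
  have A2: "A2 \<subseteq> W" "A2 \<subseteq> {k + Q * m..<k + Q * m + m}" "mono_on A2 f"
    using Suc.prems by (auto simp: A2_def intro: mono_on_subset)
  have hits1: "?hits A1 Q \<subseteq> ?hits A Q" by (auto simp: A1_def)
  show ?case
  proof (cases "A2 = {}")
    case True
    then have "A1 = A" using A12 by simp
    then have "real (card A) \<le> \<alpha> * card (?hits A Q) + \<beta> * (y - x)"
      using Suc.IH[OF A1] Suc.prems by simp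
    also have "\<dots> \<le> \<alpha> * card (?hits A (Suc Q)) + \<beta> * (y - x)"
      using \<open>0 \<le> \<alpha>\<close> by (intro add_right_mono mult_left_mono of_nat_mono card_mono) auto
    finally show ?thesis .
  next
    case False
    \<comment> \<open>The value that separates the range on the last block from the range on the earlier ones.\<close>
    define z where "z = f (Min A2)"
    have fin2: "finite A2" using finA by (simp add: A2_def)
    have min: "Min A2 \<in> A2" using False fin2 by simp
    then have minA: "Min A2 \<in> A" using A12 by auto
    have z: "x \<le> z" "z \<le> y" using Suc.prems(4) minA by (auto simp: z_def)
    have f1: "f ` A1 \<subseteq> {x..z}"
    proof clarify
      fix t assume t: "t \<in> A1"
      then have "t \<in> A" "t \<le> Min A2" using min by (auto simp: A1_def A2_def)
      then have "f t \<le> z" using Suc.prems(3) minA by (auto simp: z_def mono_on_def)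
      then show "f t \<in> {x..z}" using Suc.prems(4) \<open>t \<in> A\<close> by auto
    qed
    have f2: "f ` A2 \<subseteq> {z..y}"
    proof clarify
      fix t assume t: "t \<in> A2"
      then have "t \<in> A" "Min A2 \<le> t" using fin2 A12 by auto
      then have "z \<le> f t" using Suc.prems(3) minA by (auto simp: z_def mono_on_def)
      then show "f t \<in> {z..y}" using Suc.prems(4) \<open>t \<in> A\<close> by auto
    qed
    have "real (card A) = real (card A1) + real (card A2)"
      using finA A12 by (metis card_Un_disjoint finite_Un of_nat_add)
    also have "\<dots> \<le> (\<alpha> * card (?hits A1 Q) + \<beta> * (z - x)) + (\<alpha> + \<beta> * (y - z))"
      using Suc.IH[OF A1 f1 z(1)] bound[OF A2 f2 z(2)] by (rule add_mono)
    also have "\<dots> \<le> (\<alpha> * card (?hits A Q) + \<beta> * (z - x)) + (\<alpha> + \<beta> * (y - z))"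
      using hits1 \<open>0 \<le> \<alpha>\<close> by (intro add_right_mono mult_left_mono of_nat_mono card_mono) auto
    also have "\<dots> = \<alpha> * (card (?hits A Q) + 1) + \<beta> * (y - x)"
      by (simp add: algebra_simps)
    also have "card (?hits A Q) + 1 = card (insert Q (?hits A Q))" by simp
    also have "insert Q (?hits A Q) = ?hits A (Suc Q)"
    proof -
      have "Min A2 \<in> A \<inter> {k + Q * m..<k + Suc Q * m}" using min minA A2(2) by auto
      then show ?thesis by (auto simp: less_Suc_eq)
    qed
    finally show ?thesis .
  qed
qed

text \<open>
  A horizontal cut into strips of height h: again the height is paid for only once, and the constant
  term once per strip.
\<close>
lemma card_le_strips:
  fixes f :: "nat \<Rightarrow> real" and \<beta> \<gamma> h :: real
  assumes bound: "\<And>A x y. A \<subseteq> W \<Longrightarrow> mono_on A f \<Longrightarrow> f ` A \<subseteq> {x..y} \<Longrightarrow> x \<le> y \<Longrightarrow> y \<le> x + h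
      \<Longrightarrow> real (card A) \<le> \<gamma> + \<beta> * (y - x)"
    and "0 \<le> \<gamma>" "0 \<le> h" "finite W"
    and "A \<subseteq> W" "mono_on A f" "f ` A \<subseteq> {x..y}" "x \<le> y" "y \<le> x + Suc r * h"
  shows "real (card A) \<le> Suc r * \<gamma> + \<beta> * (y - x)"
  using assms(5-)
proof (induction r arbitrary: A y)
  case 0
  then show ?case using bound[of A x y] by simp
next
  case (Suc r)
  show ?case
  proof (cases "y \<le> x + Suc r * h")
    case True
    have "real (card A) \<le> Suc r * \<gamma> + \<beta> * (y - x)" using Suc.IH[OF Suc.prems(1-4) True] .
    also have "\<dots> \<le> Suc (Suc r) * \<gamma> + \<beta> * (y - x)" using \<open>0 \<le> \<gamma>\<close> by (simp add: algebra_simps)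
    finally show ?thesis .
  next
    case False
    define z where "z = y - h"
    have "x + Suc r * h \<le> y" using False by simp
    moreover have "h \<le> Suc r * h" using \<open>0 \<le> h\<close> by (simp add: algebra_simps)
    ultimately have "x \<le> z" unfolding z_def by linarith
    moreover have "z \<le> y" "y \<le> z + h" "z \<le> x + Suc r * h"
      using Suc.prems(5) \<open>0 \<le> h\<close> by (auto simp: z_def algebra_simps)
    ultimately have z: "x \<le> z" "z \<le> y" "y \<le> z + h" "z \<le> x + Suc r * h" by auto
    define A1 where "A1 = {t\<in>A. f t \<le> z}"
    define A2 where "A2 = {t\<in>A. z < f t}"
    have finA: "finite A" using Suc.prems(1) \<open>finite W\<close> by (rule finite_subset)
    have A12: "A = A1 \<union> A2" "A1 \<inter> A2 = {}" by (auto simp: A1_def A2_def)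
    have A1: "A1 \<subseteq> W" "mono_on A1 f" "f ` A1 \<subseteq> {x..z}"
      using Suc.prems by (auto simp: A1_def intro: mono_on_subset)
    have A2: "A2 \<subseteq> W" "mono_on A2 f" "f ` A2 \<subseteq> {z..y}"
      using Suc.prems by (auto simp: A2_def intro: mono_on_subset)
    have "real (card A) = real (card A1) + real (card A2)"
      using finA A12 by (metis card_Un_disjoint finite_Un of_nat_add)
    also have "\<dots> \<le> (Suc r * \<gamma> + \<beta> * (z - x)) + (\<gamma> + \<beta> * (y - z))"
      using Suc.IH[OF A1 z(1,4)] bound[OF A2 z(2,3)] by (rule add_mono)
    also have "\<dots> = Suc (Suc r) * \<gamma> + \<beta> * (y - x)" by (simp add: algebra_simps)
    finally show ?thesis .
  qed
qed

text \<open>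
  The induction over the scales. At the next scale, A is cut into strips of height sqrt m, where m is
  the block length of the current scale. In a strip all points are within sqrt m of the value at the
  first point k, so the strip meets at most v blocks. The number of strips is at most
  1 + (y - x) / sqrt m; the fraction in it accounts for the new summand in the coefficient of y - x.
\<close>
lemma card_increasing_le:
  fixes f :: "nat \<Rightarrow> real"
  assumes few: "\<And>k j. k \<in> W \<Longrightarrow> j < J \<Longrightarrow>
      card {q\<in>{..<K\<^sup>2}. \<exists>t\<in>{k + q * (m0 * K ^ (2 * j))..<k + Suc q * (m0 * K ^ (2 * j))}.
        \<bar>f t - f k\<bar> \<le> sqrt (real (m0 * K ^ (2 * j)))} \<le> v"
    and pos: "m0 \<ge> 1" "K \<ge> 1"
    and "j \<le> J" "A \<subseteq> W" "A \<subseteq> {lo..<lo + m0 * K ^ (2 * j)}" "mono_on A f" "f ` A \<subseteq> {x..y}" "x \<le> y"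
  shows "real (card A) \<le> real (v ^ j * m0)
      + (\<Sum>i<j. real (v ^ Suc i * m0) / sqrt (real (m0 * K ^ (2 * i)))) * (y - x)"
  using assms(4-)
proof (induction j arbitrary: A lo x y)
  case 0
  have "card A \<le> card {lo..<lo + m0}" using 0 by (intro card_mono) auto
  then show ?case by simp
next
  case (Suc j)
  define m where "m = m0 * K ^ (2 * j)"
  define \<alpha> where "\<alpha> = real (v ^ j * m0)"
  define \<beta> where "\<beta> = (\<Sum>i<j. real (v ^ Suc i * m0) / sqrt (real (m0 * K ^ (2 * i))))"
  have m: "m \<ge> 1" using pos by (simp add: m_def)
  have \<beta>: "0 \<le> \<beta>" unfolding \<beta>_def by (intro sum_nonneg) simp
  have IH: "real (card A) \<le> \<alpha> + \<beta> * (y - x)"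
    if "A \<subseteq> W" "A \<subseteq> {lo..<lo + m}" "mono_on A f" "f ` A \<subseteq> {x..y}" "x \<le> y" for A lo x y
    using Suc.IH[of A lo x y] that Suc.prems(1) by (simp add: m_def \<alpha>_def \<beta>_def)
  have win: "m0 * K ^ (2 * Suc j) = K\<^sup>2 * m" by (simp add: m_def power2_eq_square)
  let ?W = "W \<inter> {lo..<lo + K\<^sup>2 * m}"
  have flat: "real (card A) \<le> v * \<alpha> + \<beta> * (y - x)"
    if A: "A \<subseteq> ?W" "mono_on A f" "f ` A \<subseteq> {x..y}" "x \<le> y" "y \<le> x + sqrt m" for A x y
  proof (cases "A = {}")
    case True
    then show ?thesis using \<beta> \<open>x \<le> y\<close> by (simp add: \<alpha>_def)
  next
    case False
    have finA: "finite A" using A(1) by (rule finite_subset) simp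
    define k where "k = Min A"
    have kA: "k \<in> A" using False finA by (simp add: k_def)
    have kmin: "k \<le> t" if "t \<in> A" for t using that finA by (simp add: k_def)
    have "A \<subseteq> {k..<k + K\<^sup>2 * m}"
    proof
      fix t assume "t \<in> A"
      then have "t < lo + K\<^sup>2 * m" "lo \<le> k" "k \<le> t" using A(1) kA kmin by auto
      then show "t \<in> {k..<k + K\<^sup>2 * m}" by simp
    qed
    then have "real (card A) \<le> \<alpha> * card {q\<in>{..<K\<^sup>2}. A \<inter> {k + q * m..<k + Suc q * m} \<noteq> {}} + \<beta> * (y - x)"
      using A by (intro card_le_blocks[where W=W, OF IH]) (auto simp: \<alpha>_def \<beta>)
    also have "\<dots> \<le> \<alpha> * v + \<beta> * (y - x)"
    proof (intro add_right_mono mult_left_mono of_nat_mono)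
      have "{q\<in>{..<K\<^sup>2}. A \<inter> {k + q * m..<k + Suc q * m} \<noteq> {}}
        \<subseteq> {q\<in>{..<K\<^sup>2}. \<exists>t\<in>{k + q * m..<k + Suc q * m}. \<bar>f t - f k\<bar> \<le> sqrt m}"
      proof (intro Collect_mono conj_mono impI)
        fix q assume "A \<inter> {k + q * m..<k + Suc q * m} \<noteq> {}"
        then obtain t where t: "t \<in> A" "t \<in> {k + q * m..<k + Suc q * m}" by blast
        then have "f t \<in> {x..y}" "f k \<in> {x..y}" using A(3) kA by auto
        then have "\<bar>f t - f k\<bar> \<le> sqrt m" using A(5) by auto
        then show "\<exists>t\<in>{k + q * m..<k + Suc q * m}. \<bar>f t - f k\<bar> \<le> sqrt m" using t(2) by blast
      qed simp
      then have "card {q\<in>{..<K\<^sup>2}. A \<inter> {k + q * m..<k + Suc q * m} \<noteq> {}}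
        \<le> card {q\<in>{..<K\<^sup>2}. \<exists>t\<in>{k + q * m..<k + Suc q * m}. \<bar>f t - f k\<bar> \<le> sqrt m}"
        by (rule card_mono[rotated]) simp
      also have "\<dots> \<le> v" using few[of k j] kA A(1) Suc.prems(1) by (auto simp: m_def)
      finally show "card {q\<in>{..<K\<^sup>2}. A \<inter> {k + q * m..<k + Suc q * m} \<noteq> {}} \<le> v" .
    qed (simp add: \<alpha>_def)
    finally show ?thesis by (simp add: mult.commute)
  qed
  have h: "0 < sqrt m" using m by simp
  define r where "r = nat \<lfloor>(y - x) / sqrt m\<rfloor>"
  have d0: "0 \<le> (y - x) / sqrt m" using Suc.prems(6) h by simp
  then have r: "real r \<le> (y - x) / sqrt m" "(y - x) / sqrt m \<le> Suc r"
    by (simp_all add: r_def) linarith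
  have "y \<le> x + Suc r * sqrt m" using r(2) h by (simp add: field_simps)
  then have "real (card A) \<le> Suc r * (v * \<alpha>) + \<beta> * (y - x)"
    using Suc.prems h unfolding win by (intro card_le_strips[where W="?W", OF flat]) (auto simp: \<alpha>_def)
  also have "\<dots> \<le> ((y - x) / sqrt m + 1) * (v * \<alpha>) + \<beta> * (y - x)"
    using r(1) by (intro add_right_mono mult_right_mono) (auto simp: \<alpha>_def)
  also have "\<dots> = real (v ^ Suc j * m0)
      + (\<Sum>i<Suc j. real (v ^ Suc i * m0) / sqrt (real (m0 * K ^ (2 * i)))) * (y - x)"
    by (simp add: \<alpha>_def \<beta>_def m_def algebra_simps)
  finally show ?case .
qed

section \<open>Longest increasing subsequences\<close>

text \<open>
  The bounded quantifier over a finite collection of sets is the form that measurability proofs need.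
\<close>
lemma LIS_ge_iff: "b \<le> LIS f n \<longleftrightarrow> (\<exists>A\<in>{A\<in>Pow {0..<n}. b \<le> card A}. mono_on A f)"
proof -
  let ?C = "{card A | A. A \<subseteq> {0..<n} \<and> mono_on A f}"
  have "?C \<subseteq> card ` Pow {0..<n}" by auto
  then have fin: "finite ?C" by (rule finite_subset) simp
  have ne: "?C \<noteq> {}" by (auto intro!: exI[of _ "{}"])
  show ?thesis unfolding LIS_def Max_ge_iff[OF fin ne] by auto
qed

lemma LIS_le_iff: "LIS f n \<le> b \<longleftrightarrow> (\<forall>A. A \<subseteq> {0..<n} \<longrightarrow> mono_on A f \<longrightarrow> card A \<le> b)"
  using LIS_ge_iff[of "Suc b" f n] by (auto simp: not_le[symmetric] Suc_le_eq)

lemma LIS_append: "LIS f n \<le> LIS f t + LIS (\<lambda>u. f (t + u)) (n - t)"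
proof (unfold LIS_le_iff, intro allI impI)
  fix A assume A: "A \<subseteq> {0..<n}" "mono_on A f"
  define A1 where "A1 = A \<inter> {0..<t}"
  define A2 where "A2 = {u. t + u \<in> A}"
  have "A2 \<subseteq> {0..<n - t}" using A(1) by (auto simp: A2_def)
  then have fin2: "finite A2" by (rule finite_subset) simp
  have fin: "finite A1" by (simp add: A1_def)
  have "A \<subseteq> A1 \<union> (\<lambda>u. t + u) ` A2"
  proof
    fix x assume "x \<in> A"
    then show "x \<in> A1 \<union> (\<lambda>u. t + u) ` A2"
      by (cases "x < t") (auto simp: A1_def A2_def image_iff intro!: exI[of _ "x - t"])
  qed
  then have "card A \<le> card (A1 \<union> (\<lambda>u. t + u) ` A2)" using fin fin2 by (intro card_mono) auto
  also have "\<dots> \<le> card A1 + card A2"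
    by (rule order_trans[OF card_Un_le]) (simp add: card_image_le fin2)
  also have "card A1 \<le> LIS f t"
    unfolding LIS_ge_iff using A by (intro bexI[of _ A1]) (auto simp: A1_def intro: mono_on_subset)
  also have "card A2 \<le> LIS (\<lambda>u. f (t + u)) (n - t)"
    unfolding LIS_ge_iff using A \<open>A2 \<subseteq> _\<close> by (intro bexI[of _ A2]) (auto simp: A2_def mono_on_def)
  finally show "card A \<le> LIS f t + LIS (\<lambda>u. f (t + u)) (n - t)" by simp
qed

lemma LIS_mono: "m \<le> n \<Longrightarrow> LIS f m \<le> LIS f n"
  by (unfold LIS_le_iff, intro allI impI, unfold LIS_ge_iff, rule bexI) auto

lemma LIS_le: "LIS f n \<le> n"
proof (unfold LIS_le_iff, intro allI impI)
  fix A assume "A \<subseteq> {0..<n}"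
  then have "card A \<le> card {0..<n}" by (rule card_mono[rotated]) simp
  then show "card A \<le> n" by simp
qed

lemma LIS_Suc: "LIS f (Suc t) \<le> Suc (LIS f t)"
  using LIS_append[of f "Suc t" t] LIS_le[of "\<lambda>u. f (t + u)" "Suc t - t"] by simp

lemma LIS_diff_const: "LIS (\<lambda>u. f u - (c :: real)) n = LIS f n"
  by (simp add: LIS_def mono_on_def)

lemma pred_LIS_ge:
  assumes "\<And>u. u < n \<Longrightarrow> (\<lambda>\<omega>. f \<omega> u) \<in> borel_measurable N"
  shows "Measurable.pred N (\<lambda>\<omega>. b \<le> LIS (f \<omega>) n)"
  unfolding LIS_ge_iff
proof (rule pred_intros_finite(4))
  fix A assume A: "A \<in> {A\<in>Pow {0..<n}. b \<le> card A}"
  then have fin: "finite A" by (auto intro: finite_subset)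
  have le: "Measurable.pred N (\<lambda>\<omega>. f \<omega> r \<le> f \<omega> s)" if "r \<in> A" "s \<in> A" for r s
  proof -
    have [measurable]: "(\<lambda>\<omega>. f \<omega> r) \<in> borel_measurable N" "(\<lambda>\<omega>. f \<omega> s) \<in> borel_measurable N"
      using that A assms by auto
    show ?thesis by measurable
  qed
  have mono: "mono_on A g \<longleftrightarrow> (\<forall>r\<in>A. \<forall>s\<in>A. r \<le> s \<longrightarrow> g r \<le> g s)" for g :: "nat \<Rightarrow> real"
    unfolding mono_on_def by blast
  have "Measurable.pred N (\<lambda>\<omega>. \<forall>r\<in>A. \<forall>s\<in>A. r \<le> s \<longrightarrow> f \<omega> r \<le> f \<omega> s)"
  proof (intro pred_intros_finite(3)[OF fin])
    fix r s assume "r \<in> A" "s \<in> A"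
    then show "Measurable.pred N (\<lambda>\<omega>. r \<le> s \<longrightarrow> f \<omega> r \<le> f \<omega> s)"
      by (cases "r \<le> s") (simp_all add: le)
  qed
  then show "Measurable.pred N (\<lambda>\<omega>. mono_on A (f \<omega>))"
    by (simp only: mono)
qed simp

context random_walk
begin

text \<open>
  Let t be the first time at which the subsequences before t reach length l * b. They grow by at most
  one per step, so this length is attained exactly, and b more elements must come from the times from
  t on. Only the increments after t matter for those.
\<close>
lemma prob_LIS_power:
  assumes p: "\<And>t. \<P>(\<omega> in M. b \<le> LIS (\<lambda>u. S (t + u) \<omega>) n) \<le> p"
  shows "\<P>(\<omega> in M. l * b \<le> LIS (\<lambda>u. S u \<omega>) n) \<le> p ^ l"
proof (induction l)
  case (Suc l)
  have p0: "0 \<le> p" using p[of 0] measure_nonneg by (rule order_trans[rotated])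
  let ?E = "\<lambda>t \<omega>. l * b \<le> LIS (\<lambda>u. S u \<omega>) t"
  let ?G = "\<lambda>t \<omega>. b \<le> LIS (\<lambda>u. S (t + u) \<omega>) (n - t)"
  have LM: "Measurable.pred M (\<lambda>\<omega>. c \<le> LIS (\<lambda>u. S (t + u) \<omega>) k)" for c t k
    by (rule pred_LIS_ge) (rule S_measurable)
  have "\<P>(\<omega> in M. Suc l * b \<le> LIS (\<lambda>u. S u \<omega>) n) \<le> p * \<P>(\<omega> in M. \<exists>t<Suc n. ?E t \<omega>)"
  proof (rule prob_first_passage_le[where G="?G"])
    fix t assume "t < Suc n"
    show "Measurable.pred (hist {1..t}) (?E t)"
      by (rule pred_LIS_ge) (rule S_past, simp)
    have "Measurable.pred (hist {t<..}) (\<lambda>\<omega>. b \<le> LIS (\<lambda>u. S (t + u) \<omega> - S t \<omega>) (n - t))"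
      by (rule pred_LIS_ge) (rule S_future, simp)
    then show "Measurable.pred (hist {t<..}) (?G t)" by (simp only: LIS_diff_const)
    have "\<P>(\<omega> in M. ?G t \<omega>) \<le> \<P>(\<omega> in M. b \<le> LIS (\<lambda>u. S (t + u) \<omega>) n)"
    proof (rule finite_measure_mono)
      show "{\<omega>\<in>space M. ?G t \<omega>} \<subseteq> {\<omega>\<in>space M. b \<le> LIS (\<lambda>u. S (t + u) \<omega>) n}"
        using LIS_mono[of "n - t" n] by (auto intro: order_trans)
      show "{\<omega>\<in>space M. b \<le> LIS (\<lambda>u. S (t + u) \<omega>) n} \<in> events"
        using LM by (simp only: pred_def)
    qed
    also note p
    finally show "\<P>(\<omega> in M. ?G t \<omega>) \<le> p" .
  next
    fix \<omega> assume big: "Suc l * b \<le> LIS (\<lambda>u. S u \<omega>) n"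
    then have "?E n \<omega>" by simp
    then obtain t where t: "t < Suc n" "first ?E t \<omega>" using ex_first[of n "Suc n" ?E \<omega>] by auto
    have "LIS (\<lambda>u. S u \<omega>) t \<le> l * b"
    proof (cases t)
      case 0
      then show ?thesis using LIS_le[of "\<lambda>u. S u \<omega>" 0] by simp
    next
      case (Suc t')
      then have "LIS (\<lambda>u. S u \<omega>) t' < l * b" using t(2) by (auto simp: first_def not_le)
      then show ?thesis using LIS_Suc[of "\<lambda>u. S u \<omega>" t'] Suc by simp
    qed
    then have "?G t \<omega>" using big LIS_append[of "\<lambda>u. S u \<omega>" n t] by simp
    then show "\<exists>t<Suc n. first ?E t \<omega> \<and> ?G t \<omega>" using t by blast
  qed
  also have "\<P>(\<omega> in M. \<exists>t<Suc n. ?E t \<omega>) \<le> \<P>(\<omega> in M. ?E n \<omega>)"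
  proof (rule finite_measure_mono)
    show "{\<omega>\<in>space M. \<exists>t<Suc n. ?E t \<omega>} \<subseteq> {\<omega>\<in>space M. ?E n \<omega>}"
      using LIS_mono[of _ n] by (auto intro: order_trans simp: less_Suc_eq_le)
    show "{\<omega>\<in>space M. ?E n \<omega>} \<in> events"
      using LM[of "l * b" 0 n] by (simp only: pred_def add_0)
  qed
  also note Suc.IH
  finally show ?case using p0 by (simp add: mult_left_mono)
qed simp

text \<open>
  The combinatorial bound fails only if the walk returns too often to one of its levels, at one of the
  n times and one of the J scales, or leaves the band of radius H around its starting point; the band
  has height 2 * H.
\<close>
lemma prob_LIS_window_le:
  assumes tail: "\<And>k m s. K \<le> m \<Longrightarrow>
      \<P>(\<omega> in M. s * (B * K) < card {q\<in>{..<K\<^sup>2}. hit k m k (sqrt m) q \<omega>}) \<le> (1/2) ^ s"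
    and K: "K \<ge> 1" and n: "n \<le> K * K ^ (2 * J)" and H: "H \<ge> 0"
    and v: "v = s * (B * K)"
    and big: "real (v ^ J * K) + (\<Sum>i<J. real (v ^ Suc i * K) / sqrt (real (K * K ^ (2 * i)))) * (2 * H) < b"
  shows "\<P>(\<omega> in M. b \<le> LIS (\<lambda>u. S (a + u) \<omega>) n)
     \<le> n * J * (1/2) ^ s + \<P>(\<omega> in M. \<exists>t<n. H < \<bar>S (a + t) \<omega> - S a \<omega>\<bar>)"
proof -
  define Bad where "Bad k j = {\<omega>\<in>space M. v < card {q\<in>{..<K\<^sup>2}. hit k (K * K ^ (2 * j)) k (sqrt (real (K * K ^ (2 * j)))) q \<omega>}}" for k j
  define Far where "Far = {\<omega>\<in>space M. \<exists>t<n. H < \<bar>S (a + t) \<omega> - S a \<omega>\<bar>}"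
  let ?U = "\<Union>k\<in>{a..<a + n}. \<Union>j\<in>{..<J}. Bad k j"
  have Bad: "Bad k j \<in> events" for k j
    using pred_card_ge[where N=M and A="{..<K\<^sup>2}" and P="hit k (K * K ^ (2 * j)) k (sqrt (real (K * K ^ (2 * j))))" and b="Suc v"]
      hit_measurable
    by (simp only: Bad_def Suc_le_eq pred_def finite_lessThan simp_thms)
  have Far: "Far \<in> events" unfolding Far_def by measurable
  have "{\<omega>\<in>space M. b \<le> LIS (\<lambda>u. S (a + u) \<omega>) n} \<subseteq> ?U \<union> Far"
  proof (clarify, rule ccontr)
    fix \<omega> assume \<omega>: "\<omega> \<in> space M" and L: "b \<le> LIS (\<lambda>u. S (a + u) \<omega>) n"
      and nU: "\<omega> \<notin> Far" and nF: "\<omega> \<notin> ?U"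
    then obtain A0 where A0: "A0 \<subseteq> {0..<n}" "b \<le> card A0" "mono_on A0 (\<lambda>u. S (a + u) \<omega>)"
      by (auto simp: LIS_ge_iff)
    define A where "A = (\<lambda>u. a + u) ` A0"
    have cA: "card A = card A0" unfolding A_def by (rule card_image) simp
    have sub: "A \<subseteq> {a..<a + n}" using A0(1) by (auto simp: A_def)
    have "real (card A) \<le> real (v ^ J * K) + (\<Sum>i<J. real (v ^ Suc i * K) / sqrt (real (K * K ^ (2 * i))))
        * ((S a \<omega> + H) - (S a \<omega> - H))"
    proof (rule card_increasing_le[where W="{a..<a + n}" and f="\<lambda>t. S t \<omega>" and lo=a and J=J])
      fix k j assume "k \<in> {a..<a + n}" "j < J"
      then have "\<omega> \<notin> Bad k j" using nF by blast
      then show "card {q\<in>{..<K\<^sup>2}. \<exists>t\<in>{k + q * (K * K ^ (2 * j))..<k + Suc q * (K * K ^ (2 * j))}.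
        \<bar>S t \<omega> - S k \<omega>\<bar> \<le> sqrt (real (K * K ^ (2 * j)))} \<le> v"
        using \<omega> by (simp add: Bad_def hit_def not_less)
    next
      show "mono_on A (\<lambda>t. S t \<omega>)" using A0(3) by (auto simp: A_def mono_on_def)
      show "A \<subseteq> {a..<a + K * K ^ (2 * J)}" using sub n by auto
      show "(\<lambda>t. S t \<omega>) ` A \<subseteq> {S a \<omega> - H..S a \<omega> + H}"
      proof clarify
        fix t assume "t \<in> A"
        then obtain u where "t = a + u" "u < n" using A0(1) by (auto simp: A_def)
        then have "\<bar>S t \<omega> - S a \<omega>\<bar> \<le> H" using nU \<omega> by (force simp: Far_def)
        then show "S t \<omega> \<in> {S a \<omega> - H..S a \<omega> + H}" by auto
      qed
    qed (use K H sub in auto)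
    then show False using big A0(2) cA by simp
  qed
  then have "\<P>(\<omega> in M. b \<le> LIS (\<lambda>u. S (a + u) \<omega>) n) \<le> prob (?U \<union> Far)"
    using Bad Far by (intro finite_measure_mono) auto
  also have "\<dots> \<le> prob ?U + prob Far"
    using Bad Far by (intro measure_Un_le) auto
  also have "prob ?U \<le> (\<Sum>k\<in>{a..<a + n}. \<Sum>j\<in>{..<J}. prob (Bad k j))"
    using Bad by (intro order_trans[OF measure_UNION_le] sum_mono) auto
  also have "\<dots> \<le> (\<Sum>k\<in>{a..<a + n}. \<Sum>j\<in>{..<J}. (1/2) ^ s)"
    unfolding Bad_def v using K by (intro sum_mono tail) auto
  also have "\<dots> = n * J * (1/2) ^ s" by simp
  finally show ?thesis by (simp add: Far_def)
qed

end

section \<open>The range of the walk\<close>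

lemma exp_le_quadratic: "exp y \<le> 1 + y + y\<^sup>2 / 2 * exp \<bar>y\<bar>" for y :: real
proof -
  obtain t where t: "\<bar>t\<bar> \<le> \<bar>y\<bar>" "exp y = (\<Sum>m<2. y ^ m / fact m) + exp t / fact 2 * y ^ 2"
    using Maclaurin_exp_le[of y 2] by blast
  have "exp t * y\<^sup>2 \<le> exp \<bar>y\<bar> * y\<^sup>2" using t(1) by (intro mult_right_mono) auto
  then show ?thesis using t(2) by (simp add: numeral_2_eq_2 mult.commute)
qed

context random_walk
begin

text \<open>
  Having gone beyond H before time a + n, the walk is back within H / 2 at time a + n with probability
  at most 1/4.
\<close>
lemma prob_max_le:
  assumes "H > 0" "16 * \<sigma>\<^sup>2 * n \<le> H\<^sup>2"
  shows "3/4 * \<P>(\<omega> in M. \<exists>t<n. H < \<bar>S (a + t) \<omega> - S a \<omega>\<bar>) \<le> \<P>(\<omega> in M. H / 2 \<le> \<bar>S (a + n) \<omega> - S a \<omega>\<bar>)"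
proof -
  let ?E = "\<lambda>t \<omega>. a \<le> t \<and> H < \<bar>S t \<omega> - S a \<omega>\<bar>"
  \<comment> \<open>For times before a the condition on the future is made vacuous, as its probability may be small.\<close>
  let ?G = "\<lambda>t \<omega>. a \<le> t \<longrightarrow> \<bar>S (a + n) \<omega> - S t \<omega>\<bar> < H / 2"
  have "3/4 * \<P>(\<omega> in M. \<exists>t<a + n. ?E t \<omega>) \<le> \<P>(\<omega> in M. H / 2 \<le> \<bar>S (a + n) \<omega> - S a \<omega>\<bar>)"
  proof (rule prob_first_passage_ge)
    fix t assume t: "t < a + n"
    show "Measurable.pred (hist {1..t}) (?E t)"
    proof (cases "a \<le> t")
      case True
      then have [measurable]: "S t \<in> borel_measurable (hist {1..t})" "S a \<in> borel_measurable (hist {1..t})"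
        using S_past[of t t] S_past[of a t] by simp_all
      show ?thesis by measurable
    qed simp
    have [measurable]: "(\<lambda>\<omega>. S (a + n) \<omega> - S t \<omega>) \<in> borel_measurable (hist {t<..})"
      using t by (intro S_future) auto
    show "Measurable.pred (hist {t<..}) (?G t)" by measurable
    show "3/4 \<le> \<P>(\<omega> in M. ?G t \<omega>)"
    proof (cases "a \<le> t")
      case True
      have "4 * \<sigma>\<^sup>2 * real (a + n - t) \<le> 4 * \<sigma>\<^sup>2 * real n"
        using True by (intro mult_left_mono) auto
      also have "\<dots> \<le> (H / 2)\<^sup>2" using assms(2) by (simp add: power_divide)
      finally show ?thesis
        using prob_increment_small[of t "a + n" "H / 2"] True t assms by simp
    qed (simp add: prob_space)
  next
    fix t \<omega> assume "?E t \<omega>" "?G t \<omega>"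
    then show "H / 2 \<le> \<bar>S (a + n) \<omega> - S a \<omega>\<bar>" by linarith
  qed measurable
  also have "(\<lambda>\<omega>. \<exists>t<a + n. ?E t \<omega>) = (\<lambda>\<omega>. \<exists>t<n. H < \<bar>S (a + t) \<omega> - S a \<omega>\<bar>)"
  proof
    fix \<omega>
    show "(\<exists>t<a + n. ?E t \<omega>) = (\<exists>t<n. H < \<bar>S (a + t) \<omega> - S a \<omega>\<bar>)"
    proof
      assume "\<exists>t<a + n. ?E t \<omega>"
      then obtain t where "t < a + n" "?E t \<omega>" by blast
      then show "\<exists>t<n. H < \<bar>S (a + t) \<omega> - S a \<omega>\<bar>" by (intro exI[of _ "t - a"]) auto
    next
      assume "\<exists>t<n. H < \<bar>S (a + t) \<omega> - S a \<omega>\<bar>"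
      then obtain t where "t < n" "H < \<bar>S (a + t) \<omega> - S a \<omega>\<bar>" by blast
      then show "\<exists>t<a + n. ?E t \<omega>" by (intro exI[of _ "a + t"]) auto
    qed
  qed
  finally show ?thesis .
qed

lemma prob_max_le_second_moment:
  fixes n :: nat
  assumes "R > 0" "16 * \<sigma>\<^sup>2 \<le> R\<^sup>2" "n \<ge> 1"
  shows "\<P>(\<omega> in M. \<exists>t<n. R * sqrt n < \<bar>S (a + t) \<omega> - S a \<omega>\<bar>) \<le> 6 * \<sigma>\<^sup>2 / R\<^sup>2"
proof -
  let ?H = "R * sqrt n"
  have "16 * \<sigma>\<^sup>2 * n \<le> R\<^sup>2 * n" using assms(2) by (rule mult_right_mono) simp
  then have "3/4 * \<P>(\<omega> in M. \<exists>t<n. ?H < \<bar>S (a + t) \<omega> - S a \<omega>\<bar>) \<le> \<P>(\<omega> in M. ?H / 2 \<le> \<bar>S (a + n) \<omega> - S a \<omega>\<bar>)"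
    using assms by (intro prob_max_le) (auto simp: power_mult_distrib)
  also have "\<dots> \<le> \<sigma>\<^sup>2 * real (a + n - a) / (?H / 2)\<^sup>2"
    using assms by (intro chebyshev) auto
  also have "\<dots> = 4 * (\<sigma>\<^sup>2 / R\<^sup>2)" using assms by (simp add: power_mult_distrib power_divide)
  finally have "3/4 * \<P>(\<omega> in M. \<exists>t<n. ?H < \<bar>S (a + t) \<omega> - S a \<omega>\<bar>) \<le> 4 * (\<sigma>\<^sup>2 / R\<^sup>2)" .
  moreover have "0 \<le> \<sigma>\<^sup>2 / R\<^sup>2" by simp
  ultimately have "\<P>(\<omega> in M. \<exists>t<n. ?H < \<bar>S (a + t) \<omega> - S a \<omega>\<bar>) \<le> 6 * (\<sigma>\<^sup>2 / R\<^sup>2)" by linarith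
  then show ?thesis by simp
qed

text \<open>
  As the mean is 0, the quadratic Taylor bound for exp leaves an error of order \<theta>^2.
\<close>
lemma mgf_le:
  assumes t: "t > 0" and int: "integrable M (\<lambda>\<omega>. exp (t * \<bar>X 1 \<omega>\<bar>))" and \<theta>: "\<bar>\<theta>\<bar> \<le> t / 2"
  shows "integrable M (\<lambda>\<omega>. exp (\<theta> * X 1 \<omega>))"
    and "expectation (\<lambda>\<omega>. exp (\<theta> * X 1 \<omega>)) \<le> exp (4 / t\<^sup>2 * expectation (\<lambda>\<omega>. exp (t * \<bar>X 1 \<omega>\<bar>)) * \<theta>\<^sup>2)"
proof -
  note [measurable] = X_measurable[of 1, OF order_refl]
  let ?E = "expectation (\<lambda>\<omega>. exp (t * \<bar>X 1 \<omega>\<bar>))"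
  have "\<theta> * x \<le> t * \<bar>x\<bar>" for x
  proof -
    have "\<theta> * x \<le> \<bar>\<theta>\<bar> * \<bar>x\<bar>" by (simp add: abs_mult[symmetric])
    also have "\<dots> \<le> t * \<bar>x\<bar>" using \<theta> t by (intro mult_right_mono) auto
    finally show ?thesis .
  qed
  then have "AE \<omega> in M. norm (exp (\<theta> * X 1 \<omega>)) \<le> norm (exp (t * \<bar>X 1 \<omega>\<bar>))" by simp
  then show i: "integrable M (\<lambda>\<omega>. exp (\<theta> * X 1 \<omega>))"
    by (rule Bochner_Integration.integrable_bound[OF int, rotated]) measurable
  have pt: "exp (\<theta> * x) \<le> 1 + \<theta> * x + 4 / t\<^sup>2 * exp (t * \<bar>x\<bar>) * \<theta>\<^sup>2" for x
  proof -
    \<comment> \<open>One half of the exponential moment absorbs the factor x^2, the other half the Taylor remainder.\<close>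
    have "(t * \<bar>x\<bar> / 2)\<^sup>2 / 2 \<le> exp (t * \<bar>x\<bar> / 2)"
    proof -
      have "0 \<le> t * \<bar>x\<bar> / 2" using t by simp
      from exp_lower_Taylor_quadratic[OF this] this show ?thesis by linarith
    qed
    then have "x\<^sup>2 \<le> 8 / t\<^sup>2 * exp (t * \<bar>x\<bar> / 2)"
      using t by (simp add: power_mult_distrib power_divide field_simps)
    then have "\<theta>\<^sup>2 / 2 * x\<^sup>2 \<le> \<theta>\<^sup>2 / 2 * (8 / t\<^sup>2 * exp (t * \<bar>x\<bar> / 2))"
      by (rule mult_left_mono) simp
    then have 1: "(\<theta> * x)\<^sup>2 / 2 \<le> \<theta>\<^sup>2 * (4 / t\<^sup>2 * exp (t * \<bar>x\<bar> / 2))"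
      by (simp add: power_mult_distrib)
    have "\<bar>\<theta> * x\<bar> \<le> t * \<bar>x\<bar> / 2"
      using mult_right_mono[OF \<theta>, of "\<bar>x\<bar>"] by (simp add: abs_mult)
    then have "(\<theta> * x)\<^sup>2 / 2 * exp \<bar>\<theta> * x\<bar> \<le> (\<theta>\<^sup>2 * (4 / t\<^sup>2 * exp (t * \<bar>x\<bar> / 2))) * exp (t * \<bar>x\<bar> / 2)"
      using 1 by (intro mult_mono) auto
    also have "\<dots> = 4 / t\<^sup>2 * (exp (t * \<bar>x\<bar> / 2) * exp (t * \<bar>x\<bar> / 2)) * \<theta>\<^sup>2" by simp
    also have "exp (t * \<bar>x\<bar> / 2) * exp (t * \<bar>x\<bar> / 2) = exp (t * \<bar>x\<bar>)"
      by (simp add: exp_add[symmetric])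
    finally show ?thesis using exp_le_quadratic[of "\<theta> * x"] by linarith
  qed
  have mi: "integrable M (X 1)" "expectation (X 1) = 0" using moments[of 1] by auto
  have "expectation (\<lambda>\<omega>. exp (\<theta> * X 1 \<omega>)) \<le> expectation (\<lambda>\<omega>. 1 + \<theta> * X 1 \<omega> + 4 / t\<^sup>2 * exp (t * \<bar>X 1 \<omega>\<bar>) * \<theta>\<^sup>2)"
    using mi int by (intro integral_mono i pt Bochner_Integration.integrable_add) auto
  also have "\<dots> = 1 + \<theta> * 0 + 4 / t\<^sup>2 * ?E * \<theta>\<^sup>2"
    using mi int by (simp add: prob_space)
  also have "\<dots> \<le> exp (4 / t\<^sup>2 * ?E * \<theta>\<^sup>2)"
    using exp_ge_add_one_self[of "4 / t\<^sup>2 * ?E * \<theta>\<^sup>2"] by simp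
  finally show "expectation (\<lambda>\<omega>. exp (\<theta> * X 1 \<omega>)) \<le> exp (4 / t\<^sup>2 * ?E * \<theta>\<^sup>2)" .
qed

lemma mgf_increment:
  assumes "integrable M (\<lambda>\<omega>. exp (\<theta> * X 1 \<omega>))"
  shows "integrable M (\<lambda>\<omega>. exp (\<theta> * (S (a + n) \<omega> - S a \<omega>)))"
    and "expectation (\<lambda>\<omega>. exp (\<theta> * (S (a + n) \<omega> - S a \<omega>))) = expectation (\<lambda>\<omega>. exp (\<theta> * X 1 \<omega>)) ^ n"
proof -
  let ?I = "{a<..a + n}"
  have prod: "exp (\<theta> * (S (a + n) \<omega> - S a \<omega>)) = (\<Prod>i\<in>?I. exp (\<theta> * X i \<omega>))" for \<omega>
    by (simp add: S_diff sum_distrib_left exp_sum)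
  have ind: "indep_vars (\<lambda>_. borel) (\<lambda>i \<omega>. exp (\<theta> * X i \<omega>)) ?I"
    by (rule indep_vars_compose2[where X=X, OF indep_vars_subset[OF indep]]) auto
  have same: "integrable M (\<lambda>\<omega>. exp (\<theta> * X i \<omega>))"
     "expectation (\<lambda>\<omega>. exp (\<theta> * X i \<omega>)) = expectation (\<lambda>\<omega>. exp (\<theta> * X 1 \<omega>))" if "i \<in> ?I" for i
  proof -
    have i: "i \<ge> 1" using that by auto
    note [measurable] = X_measurable[OF i] X_measurable[of 1, OF order_refl]
    have "integrable M (\<lambda>\<omega>. exp (\<theta> * X i \<omega>)) \<longleftrightarrow> integrable (distr M borel (X i)) (\<lambda>x. exp (\<theta> * x))"
      by (rule integrable_distr_eq[symmetric]) measurable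
    also have "\<dots> \<longleftrightarrow> integrable M (\<lambda>\<omega>. exp (\<theta> * X 1 \<omega>))"
      unfolding ident[OF i] by (rule integrable_distr_eq) measurable
    finally show "integrable M (\<lambda>\<omega>. exp (\<theta> * X i \<omega>))" using assms by blast
    have "expectation (\<lambda>\<omega>. exp (\<theta> * X i \<omega>)) = (LINT x|distr M borel (X i). exp (\<theta> * x))"
      by (rule integral_distr[symmetric]) measurable
    also have "\<dots> = expectation (\<lambda>\<omega>. exp (\<theta> * X 1 \<omega>))"
      unfolding ident[OF i] by (rule integral_distr) measurable
    finally show "expectation (\<lambda>\<omega>. exp (\<theta> * X i \<omega>)) = expectation (\<lambda>\<omega>. exp (\<theta> * X 1 \<omega>))" .
  qed
  show "integrable M (\<lambda>\<omega>. exp (\<theta> * (S (a + n) \<omega> - S a \<omega>)))"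
    unfolding prod by (rule indep_vars_integrable[OF _ ind same(1)]) auto
  have "expectation (\<lambda>\<omega>. \<Prod>i\<in>?I. exp (\<theta> * X i \<omega>)) = (\<Prod>i\<in>?I. expectation (\<lambda>\<omega>. exp (\<theta> * X i \<omega>)))"
    by (rule indep_vars_lebesgue_integral[OF _ ind same(1)]) auto
  also have "\<dots> = (\<Prod>i\<in>?I. expectation (\<lambda>\<omega>. exp (\<theta> * X 1 \<omega>)))"
    by (rule prod.cong[OF refl same(2)])
  finally show "expectation (\<lambda>\<omega>. exp (\<theta> * (S (a + n) \<omega> - S a \<omega>))) = expectation (\<lambda>\<omega>. exp (\<theta> * X 1 \<omega>)) ^ n"
    unfolding prod by simp
qed

text \<open>
  Chernoff's bound with \<theta> = 1 / sqrt n, where n steps contribute only a constant factor to the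
  exponential moment.
\<close>
lemma increment_exponential_tail:
  assumes t: "t > 0" and int: "integrable M (\<lambda>\<omega>. exp (t * \<bar>X 1 \<omega>\<bar>))"
    and n: "n \<ge> 1" "1 / sqrt n \<le> t / 2"
  shows "\<P>(\<omega> in M. x * sqrt n \<le> \<bar>S (a + n) \<omega> - S a \<omega>\<bar>)
    \<le> 2 * exp (4 / t\<^sup>2 * expectation (\<lambda>\<omega>. exp (t * \<bar>X 1 \<omega>\<bar>)) - x)"
proof -
  let ?C = "4 / t\<^sup>2 * expectation (\<lambda>\<omega>. exp (t * \<bar>X 1 \<omega>\<bar>))"
  have one: "\<P>(\<omega> in M. x \<le> \<theta> * (S (a + n) \<omega> - S a \<omega>)) \<le> exp (?C - x)" if \<theta>: "\<bar>\<theta>\<bar> = 1 / sqrt n" for \<theta>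
  proof -
    have \<theta>': "\<bar>\<theta>\<bar> \<le> t / 2" using \<theta> n by simp
    have "\<P>(\<omega> in M. x \<le> \<theta> * (S (a + n) \<omega> - S a \<omega>)) = \<P>(\<omega> in M. exp x \<le> exp (\<theta> * (S (a + n) \<omega> - S a \<omega>)))"
      by simp
    also have "\<dots> \<le> expectation (\<lambda>\<omega>. exp (\<theta> * (S (a + n) \<omega> - S a \<omega>))) / exp x"
      using mgf_increment(1)[OF mgf_le(1)[OF t int \<theta>']]
      by (intro integral_Markov_inequality_measure[where A="{}"]) auto
    also have "\<dots> = expectation (\<lambda>\<omega>. exp (\<theta> * X 1 \<omega>)) ^ n / exp x"
      by (simp only: mgf_increment(2)[OF mgf_le(1)[OF t int \<theta>']])
    also have "\<dots> \<le> exp (?C * \<theta>\<^sup>2) ^ n / exp x"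
      using mgf_le(2)[OF t int \<theta>'] by (intro divide_right_mono power_mono) auto
    also have "exp (?C * \<theta>\<^sup>2) ^ n = exp (n * (?C * \<theta>\<^sup>2))" by (rule exp_of_nat_mult[symmetric])
    also have "\<theta>\<^sup>2 = (1 / sqrt n)\<^sup>2" using \<theta> by (metis power2_abs)
    also have "n * (?C * (1 / sqrt n)\<^sup>2) = ?C" using n by (simp add: power_divide)
    finally show ?thesis by (simp add: exp_diff)
  qed
  let ?A = "{\<omega>\<in>space M. x \<le> 1 / sqrt n * (S (a + n) \<omega> - S a \<omega>)}"
  let ?B = "{\<omega>\<in>space M. x \<le> - (1 / sqrt n) * (S (a + n) \<omega> - S a \<omega>)}"
  have "\<P>(\<omega> in M. x * sqrt n \<le> \<bar>S (a + n) \<omega> - S a \<omega>\<bar>) \<le> prob (?A \<union> ?B)"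
  proof (rule finite_measure_mono)
    show "{\<omega>\<in>space M. x * sqrt n \<le> \<bar>S (a + n) \<omega> - S a \<omega>\<bar>} \<subseteq> ?A \<union> ?B"
      using n by (auto simp: field_simps abs_if split: if_splits)
  qed measurable
  also have "\<dots> \<le> prob ?A + prob ?B" by (rule measure_Un_le) measurable
  also have "\<dots> \<le> exp (?C - x) + exp (?C - x)" by (intro add_mono one) auto
  finally show ?thesis by simp
qed

end

section \<open>The choice of the scales\<close>

text \<open>
  With ratio K^2 between successive time scales, K = 2 powr L and n = 4 powr N, there are N / L scales.
  Each costs a factor of order N, a total of 2 powr (2 * (N / L) * log 4 N) up to lower order, and
  rounding costs powers of K. These losses balance when L^2 = N * log 4 N.
\<close>
definition scale_exponent :: "real \<Rightarrow> real" where
  "scale_exponent N = sqrt (N * log 4 N)"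

text \<open>
  In units of L, the exponents of 2 beyond N are as follows. The J factors s * B cost 2, because s * B
  is O(N) and (N / L) * log 4 N = L. The constant term of the combinatorial bound costs 1 more since
  K^J overshoots 2 powr N by up to a factor K, and 1 more for the shortest window, which has K times.
  The height term costs 2 for a factor K^2 and 1/2 for the range of the walk. Everything else,
  including the constant B through c, is of lower order and fits into the remaining L / 2, which is the
  assumption small1. The choice s = 4 N beats the union over 4 powr N times.
\<close>
lemma scale_parameters:
  fixes N c :: real and B :: nat
  defines "L \<equiv> scale_exponent N" and "\<l> \<equiv> log 4 N"
  defines "r \<equiv> nat \<lceil>L\<rceil>" and "J \<equiv> nat \<lceil>N / L\<rceil>" and "s \<equiv> nat \<lceil>4 * N\<rceil>"
  defines "K \<equiv> (2::nat) ^ r"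
  defines "v \<equiv> s * (B * K)"
  assumes B: "B \<ge> 1" and c: "c = log 2 (5 * real B)"
    and N: "N \<ge> 2" and L1: "L \<ge> 1"
    and small1: "N / L * (c + 1) + c + 2 * \<l> + 6 \<le> L / 2"
    and small2: "N / L + 2 \<le> N"
  shows "N \<le> real r * real J"
    and "real (v ^ J * K) + (\<Sum>i<J. real (v ^ Suc i * K) / sqrt (real (K * K ^ (2 * i))))
        * (2 * (2 powr (L / 2) * 2 powr N)) < nat \<lfloor>2 powr N * 2 powr (5 * L)\<rfloor>"
    and "4 powr N * J * (1/2) ^ s \<le> 2 powr (- N) / 2"
proof -
  have L0: "L > 0" using L1 by simp
  have \<l>0: "\<l> > 0" using N by (simp add: \<l>_def)
  have LL: "N / L * \<l> = L"
  proof -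
    have "L * L = N * \<l>" using N \<l>0 by (simp add: L_def scale_exponent_def \<l>_def)
    then show ?thesis using L0 by (simp add: field_simps)
  qed
  have NL0: "0 < N / L" using N L0 by simp
  have up: "x \<le> real (nat \<lceil>x\<rceil>)" "0 < x \<Longrightarrow> real (nat \<lceil>x\<rceil>) \<le> x + 1" for x :: real
    using of_int_ceiling_le_add_one[of x] real_nat_ceiling_ge[of x] by auto
  have r: "L \<le> r" "r \<le> L + 1" using up[of L] L0 by (simp_all only: r_def)
  have J: "N / L \<le> J" "J \<le> N / L + 1" using up[of "N / L"] NL0 by (simp_all only: J_def)
  have s: "4 * N \<le> s" "s \<le> 5 * N" using up[of "4 * N"] N by (simp_all only: s_def) linarith
  have "N = L * (N / L)" using L0 by simp
  also have "\<dots> \<le> real r * real J" using r(1) J(1) L0 NL0 by (intro mult_mono) auto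
  finally show NrJ: "N \<le> real r * real J" .

  define g where "g = s * B"
  have "0 < real s" using s(1) N by linarith
  then have g1: "1 \<le> g" using B by (simp add: g_def)
  have "real g \<le> 5 * real B * N" using mult_right_mono[OF s(2), of "real B"] by (simp add: g_def mult_ac)
  then have "log 2 g \<le> log 2 (5 * real B * N)" using g1 by (intro log_mono) auto
  also have "\<dots> = c + log 2 N" using B N by (simp add: c log_mult)
  also have "log 2 N = 2 * \<l>"
    using log_base_pow[of "2::real" 2 N] by (simp add: \<l>_def)
  finally have lg: "log 2 g \<le> c + 2 * \<l>" .
  have lg0: "0 \<le> log 2 g" using g1 by simp
  define e where "e = 2 * L + N / L * c + c + 2 * \<l>"
  have "real g ^ J = 2 powr (J * log 2 g)"
    using g1 by (simp add: powr_powr[symmetric] mult.commute[of "real J"] powr_realpow)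
  also have "\<dots> \<le> 2 powr e"
  proof (rule powr_mono)
    have "J * log 2 g \<le> (N / L + 1) * (c + 2 * \<l>)"
      using J(2) lg lg0 NL0 by (intro mult_mono) auto
    also have "\<dots> = 2 * (N / L * \<l>) + N / L * c + c + 2 * \<l>" by (simp add: algebra_simps)
    finally show "J * log 2 g \<le> e" by (simp only: LL e_def)
  qed simp
  finally have gJ: "real g ^ J \<le> 2 powr e" .
  have K: "real K = 2 powr r" by (simp add: K_def powr_realpow)
  have K1: "1 \<le> real K" by (simp add: K_def)
  have Kle: "real K \<le> 2 powr (L + 1)" unfolding K using r(2) by (intro powr_mono) auto
  have KJ: "real K ^ J \<le> 2 powr (N + L + N / L + 1)"
  proof -
    have "real K ^ J = 2 powr (real r * real J)"
      unfolding K by (simp add: powr_powr[symmetric] powr_realpow)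
    also have "\<dots> \<le> 2 powr (N + L + N / L + 1)"
    proof (rule powr_mono)
      have "real r * real J \<le> (L + 1) * (N / L + 1)" using r J L0 NL0 by (intro mult_mono) auto
      also have "\<dots> = N + L + N / L + 1" using L0 by (simp add: field_simps)
      finally show "real r * real J \<le> N + L + N / L + 1" .
    qed simp
    finally show ?thesis .
  qed
  have vg: "v = g * K" by (simp add: v_def g_def)
  let ?T = "2 powr (N + 5 * L)"
  have first_part: "real (v ^ J * K) \<le> ?T / 4"
  proof -
    have "real (v ^ J * K) = real g ^ J * real K ^ J * real K" by (simp add: vg power_mult_distrib)
    also have "\<dots> \<le> 2 powr e * 2 powr (N + L + N / L + 1) * 2 powr (L + 1)"
      by (intro mult_mono gJ KJ Kle) auto
    also have "\<dots> = 2 powr (e + (N + L + N / L + 1) + (L + 1))" by (simp only: powr_add)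
    also have "\<dots> \<le> 2 powr (N + 5 * L - 2)"
    proof (rule powr_mono)
      have "N / L * c + N / L = N / L * (c + 1)" by (simp only: distrib_left mult_1_right)
      then show "e + (N + L + N / L + 1) + (L + 1) \<le> N + 5 * L - 2"
        using small1 L0 unfolding e_def by linarith
    qed simp
    also have "\<dots> = ?T / 4" by (simp add: powr_diff powr_numeral)
    finally show ?thesis .
  qed
  have J2: "real J \<le> 2 powr (N / L + 1)"
  proof -
    have "J < 2 ^ J" by (rule less_exp)
    then have "real J \<le> 2 ^ J" by (metis less_imp_le of_nat_le_iff of_nat_numeral of_nat_power)
    also have "\<dots> = 2 powr J" by (simp add: powr_realpow)
    also have "\<dots> \<le> 2 powr (N / L + 1)" using J(2) by (intro powr_mono) auto
    finally show ?thesis .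
  qed
  have second_part: "(\<Sum>i<J. real (v ^ Suc i * K) / sqrt (real (K * K ^ (2 * i))))
        * (2 * (2 powr (L / 2) * 2 powr N)) \<le> ?T / 4"
  proof -
    have "real (v ^ Suc i * K) / sqrt (real (K * K ^ (2 * i))) \<le> real g ^ J * real K * real K"
      if "i < J" for i
    proof -
      have "real K ^ i = sqrt ((real K ^ i)\<^sup>2)" using K1 by simp
      also have "(real K ^ i)\<^sup>2 = 1 * real K ^ (2 * i)" by (simp add: power_mult[symmetric] mult.commute)
      also have "sqrt \<dots> \<le> sqrt (real K * real K ^ (2 * i))"
        using K1 by (intro real_sqrt_le_mono mult_right_mono) auto
      finally have d: "real K ^ i \<le> sqrt (real (K * K ^ (2 * i)))" by simp
      have "real (v ^ Suc i * K) / sqrt (real (K * K ^ (2 * i))) \<le> real (v ^ Suc i * K) / real K ^ i"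
        using d K1 by (intro divide_left_mono mult_pos_pos) (auto simp: K_def)
      also have "\<dots> = real g ^ Suc i * real K * real K"
        using K1 by (simp add: vg power_mult_distrib)
      also have "\<dots> \<le> real g ^ J * real K * real K"
        using g1 K1 that by (intro mult_right_mono power_increasing) auto
      finally show ?thesis .
    qed
    then have "(\<Sum>i<J. real (v ^ Suc i * K) / sqrt (real (K * K ^ (2 * i)))) \<le> (\<Sum>i<J. real g ^ J * real K * real K)"
      by (intro sum_mono) auto
    also have "\<dots> = real J * (real g ^ J * real K * real K)" by simp
    also have "\<dots> \<le> 2 powr (N / L + 1) * (2 powr e * 2 powr (L + 1) * 2 powr (L + 1))"
      by (intro mult_mono gJ J2 Kle) auto
    finally have "(\<Sum>i<J. real (v ^ Suc i * K) / sqrt (real (K * K ^ (2 * i))))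
        * (2 * (2 powr (L / 2) * 2 powr N))
      \<le> 2 powr (N / L + 1) * (2 powr e * 2 powr (L + 1) * 2 powr (L + 1)) * (2 powr 1 * (2 powr (L / 2) * 2 powr N))"
      by (simp add: mult_right_mono)
    also have "\<dots> = 2 powr ((N / L + 1) + (e + (L + 1) + (L + 1)) + (1 + (L / 2 + N)))"
      by (simp only: powr_add)
    also have "\<dots> \<le> 2 powr (N + 5 * L - 2)"
    proof (rule powr_mono)
      have "N / L * c + N / L = N / L * (c + 1)" by (simp only: distrib_left mult_1_right)
      then show "(N / L + 1) + (e + (L + 1) + (L + 1)) + (1 + (L / 2 + N)) \<le> N + 5 * L - 2"
        using small1 unfolding e_def by linarith
    qed simp
    also have "\<dots> = ?T / 4" by (simp add: powr_diff powr_numeral)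
    finally show ?thesis .
  qed
  have "2 powr 2 \<le> ?T" using N L0 by (intro powr_mono) auto
  then have "4 \<le> ?T" by simp
  then have gap: "?T / 4 + ?T / 4 < ?T - 1" by linarith
  have floor: "?T - 1 \<le> real (nat \<lfloor>?T\<rfloor>)"
    using \<open>4 \<le> ?T\<close> of_int_floor_le[of ?T] floor_correct[of ?T] by simp
  have "2 powr N * 2 powr (5 * L) = ?T" by (simp add: powr_add)
  with add_mono[OF first_part second_part] gap floor
  show "real (v ^ J * K) + (\<Sum>i<J. real (v ^ Suc i * K) / sqrt (real (K * K ^ (2 * i))))
        * (2 * (2 powr (L / 2) * 2 powr N)) < nat \<lfloor>2 powr N * 2 powr (5 * L)\<rfloor>"
    by (simp only:)

  have "(1/2::real) ^ s = 2 powr (- real s)"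
    by (simp add: powr_minus powr_realpow power_one_over inverse_eq_divide)
  also have "\<dots> \<le> 2 powr (- (4 * N))" using s(1) by (intro powr_mono) auto
  finally have hs: "(1/2::real) ^ s \<le> 2 powr (- (4 * N))" .
  have "(4::real) powr N = (2 powr 2) powr N" by simp
  then have four: "(4::real) powr N = 2 powr (2 * N)" by (simp only: powr_powr)
  have "4 powr N * J * (1/2) ^ s \<le> 2 powr (2 * N) * 2 powr (N / L + 1) * 2 powr (- (4 * N))"
    unfolding four by (intro mult_mono J2 hs) auto
  also have "\<dots> = 2 powr (2 * N + (N / L + 1) + (- (4 * N)))" by (simp only: powr_add)
  also have "\<dots> \<le> 2 powr (- N - 1)" using small2 by (intro powr_mono) auto
  also have "\<dots> = 2 powr (- N) / 2" by (simp add: powr_diff)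
  finally show "4 powr N * J * (1/2) ^ s \<le> 2 powr (- N) / 2" .
qed

text \<open>
  L is of larger order than N / L and log N, while 2 powr L, and with it 2 powr N, is of larger order
  than every power of N.
\<close>
lemma scale_exponent_asymptotics:
  "((\<lambda>N. N / scale_exponent N / scale_exponent N) \<longlongrightarrow> 0) at_top"
  "((\<lambda>N. log 4 N / scale_exponent N) \<longlongrightarrow> 0) at_top"
  "filterlim scale_exponent at_top at_top"
  "\<forall>\<^sub>F N in at_top. N / scale_exponent N + 2 \<le> N"
  "\<forall>\<^sub>F N in at_top. (2::real) powr (- N) / 2 \<le> 1 / N\<^sup>2"
  "((\<lambda>N. N\<^sup>2 * (2::real) powr (- scale_exponent N)) \<longlongrightarrow> 0) at_top"
  "((\<lambda>N. N / (2::real) powr (scale_exponent N / 2)) \<longlongrightarrow> 0) at_top"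
  unfolding scale_exponent_def by real_asymp+

lemma small_exponents:
  fixes c :: real
  assumes "c \<ge> 0"
  shows "\<forall>\<^sub>F N in at_top. N / scale_exponent N * (c + 1) + c + 2 * log 4 N + 6 \<le> scale_exponent N / 2"
proof -
  have "\<forall>\<^sub>F N in at_top. N / scale_exponent N / scale_exponent N < 1 / (8 * (c + 1))"
    using scale_exponent_asymptotics(1) by (rule order_tendstoD(2)) (use assms in simp)
  moreover have "\<forall>\<^sub>F N in at_top. log 4 N / scale_exponent N < 1 / 16"
    using scale_exponent_asymptotics(2) by (rule order_tendstoD(2)) simp
  moreover have "\<forall>\<^sub>F N in at_top. 8 * c + 48 \<le> scale_exponent N"
    using scale_exponent_asymptotics(3) by (simp add: filterlim_at_top)
  ultimately show ?thesis
  proof eventually_elim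
    case (elim N)
    let ?L = "scale_exponent N"
    have L: "?L > 0" using elim(3) assms by linarith
    have "N / ?L < 1 / (8 * (c + 1)) * ?L" using elim(1) L by (simp only: pos_divide_less_eq)
    then have "N / ?L * (c + 1) \<le> 1 / (8 * (c + 1)) * ?L * (c + 1)"
      using assms by (intro mult_right_mono) auto
    also have "\<dots> = ?L / 8"
    proof -
      have "1 / (8 * d) * ?L * d = ?L / 8" if "d \<noteq> 0" for d using that by simp
      from this[of "c + 1"] show ?thesis using assms by linarith
    qed
    finally have "N / ?L * (c + 1) \<le> ?L / 8" .
    moreover have "log 4 N < 1 / 16 * ?L" using elim(2) L by (simp only: pos_divide_less_eq)
    ultimately show ?case using elim(3) L by linarith
  qed
qed

lemma log4_at_top: "filterlim (\<lambda>n. log 4 (real n)) at_top sequentially"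
  by real_asymp

lemma powr_log4:
  fixes n :: nat
  assumes "n \<ge> 1"
  shows "4 powr (log 4 n) = real n" "2 powr (log 4 n) = sqrt n"
proof -
  show four: "4 powr (log 4 n) = real n" using assms by simp
  have "(2 powr (log 4 n))\<^sup>2 = 2 powr (2 * log 4 n)" by (simp add: powr_power mult.commute)
  also have "\<dots> = (2 powr 2) powr (log 4 n)" by (simp only: powr_powr)
  also have "\<dots> = real n" using four by simp
  finally show "2 powr (log 4 n) = sqrt n" by (intro real_sqrt_unique[symmetric]) auto
qed

section \<open>The tail of the longest increasing subsequence\<close>

context random_walk
begin

abbreviation LIS_bound :: "nat \<Rightarrow> real" where
  "LIS_bound n \<equiv> sqrt n * 2 powr (5 * scale_exponent (log 4 n))"

text \<open>
  The right-hand side separates the returns to levels, whose probability is negligible for both parts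
  of the theorem, from the range of the walk, for which the moment assumptions matter. Uniformity in
  the starting time a is what the restarts need.
\<close>
lemma eventually_prob_LIS_window_le:
  "\<forall>\<^sub>F n in sequentially. \<forall>a.
    \<P>(\<omega> in M. nat \<lfloor>LIS_bound n\<rfloor> \<le> LIS (\<lambda>u. S (a + u) \<omega>) n)
    \<le> 2 powr (- log 4 n) / 2
      + \<P>(\<omega> in M. \<exists>t<n. 2 powr (scale_exponent (log 4 n) / 2) * sqrt n < \<bar>S (a + t) \<omega> - S a \<omega>\<bar>)"
proof -
  obtain B where B: "B \<ge> 1" and tail: "\<And>k m K s. 1 \<le> K \<Longrightarrow> K \<le> m \<Longrightarrow>
     \<P>(\<omega> in M. s * (B * K) < card {q\<in>{..<K\<^sup>2}. hit k m k (sqrt m) q \<omega>}) \<le> (1/2) ^ s"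
    using level_hits_tail by blast
  define c where "c = log 2 (5 * real B)"
  have c0: "c \<ge> 0" using B by (simp add: c_def)
  have "\<forall>\<^sub>F N in at_top. 2 \<le> N \<and> 1 \<le> scale_exponent N \<and>
      N / scale_exponent N * (c + 1) + c + 2 * log 4 N + 6 \<le> scale_exponent N / 2 \<and>
      N / scale_exponent N + 2 \<le> N"
    using scale_exponent_asymptotics(3)
    by (intro eventually_conj small_exponents c0 scale_exponent_asymptotics(4) eventually_ge_at_top)
       (simp add: filterlim_at_top)
  from eventually_compose_filterlim[OF this log4_at_top] eventually_ge_at_top[of 1]
  show ?thesis
  proof eventually_elim
    case (elim n)
    define N where "N = log 4 (real n)"
    define L where "L = scale_exponent N"
    define r where "r = nat \<lceil>L\<rceil>"
    define J where "J = nat \<lceil>N / L\<rceil>"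
    define s where "s = nat \<lceil>4 * N\<rceil>"
    define K where "K = (2::nat) ^ r"
    define v where "v = s * (B * K)"
    have n: "4 powr N = real n" "2 powr N = sqrt n" using powr_log4[OF elim(2)] by (simp_all add: N_def)
    note par = scale_parameters[of B c N, OF B c_def, folded L_def, folded r_def J_def s_def,
        folded K_def, folded v_def]
    have hyp: "2 \<le> N" "1 \<le> L" "N / L * (c + 1) + c + 2 * log 4 N + 6 \<le> L / 2" "N / L + 2 \<le> N"
      using elim(1) by (auto simp: N_def L_def)
    note par = par[OF hyp]
    have K1: "K \<ge> 1" by (simp add: K_def)
    have "real n \<le> 4 powr (real r * real J)"
      using par(1) n(1) by (metis one_le_numeral powr_mono)
    also have "\<dots> = (4 ^ r) ^ J" by (simp add: powr_powr[symmetric] powr_realpow)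
    also have "\<dots> = real (K ^ (2 * J))"
    proof -
      have "(4::real) ^ r = (2 ^ r)\<^sup>2" by (simp add: power_even_eq power2_eq_square power_mult_distrib[symmetric])
      then show ?thesis by (simp add: K_def power_mult)
    qed
    finally have "n \<le> K ^ (2 * J)" by (simp only: of_nat_le_iff)
    also have "\<dots> \<le> K * K ^ (2 * J)" using K1 by simp
    finally have nK: "n \<le> K * K ^ (2 * J)" .
    show ?case
    proof
      fix a
      let ?H = "2 powr (L / 2) * sqrt n"
      have "\<P>(\<omega> in M. nat \<lfloor>LIS_bound n\<rfloor> \<le> LIS (\<lambda>u. S (a + u) \<omega>) n)
        \<le> real n * real J * (1/2) ^ s + \<P>(\<omega> in M. \<exists>t<n. ?H < \<bar>S (a + t) \<omega> - S a \<omega>\<bar>)"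
      proof (rule prob_LIS_window_le[OF tail[OF K1] K1 nK _ v_def])
        show "real (v ^ J * K) + (\<Sum>i<J. real (v ^ Suc i * K) / sqrt (real (K * K ^ (2 * i)))) * (2 * ?H)
          < real (nat \<lfloor>LIS_bound n\<rfloor>)"
          using par(2) unfolding n(2) by (simp only: N_def L_def)
      qed simp_all
      moreover have "real n * real J * (1/2) ^ s \<le> 2 powr (- N) / 2" using par(3) unfolding n(1) .
      ultimately show "\<P>(\<omega> in M. nat \<lfloor>LIS_bound n\<rfloor> \<le> LIS (\<lambda>u. S (a + u) \<omega>) n)
        \<le> 2 powr (- log 4 n) / 2
          + \<P>(\<omega> in M. \<exists>t<n. 2 powr (scale_exponent (log 4 n) / 2) * sqrt n < \<bar>S (a + t) \<omega> - S a \<omega>\<bar>)"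
        unfolding N_def L_def by linarith
    qed
  qed
qed

text \<open>
  The pieces of the path have integer lengths, so the threshold x is rounded down.
\<close>
lemma prob_LIS_ge_multiple:
  assumes "\<And>a. \<P>(\<omega> in M. nat \<lfloor>x\<rfloor> \<le> LIS (\<lambda>u. S (a + u) \<omega>) n) \<le> p" and "0 \<le> x"
  shows "\<P>(\<omega> in M. real l * x \<le> real (LIS (partial_sum X \<omega>) n)) \<le> p ^ l"
proof -
  have "\<P>(\<omega> in M. real l * x \<le> real (LIS (partial_sum X \<omega>) n))
    \<le> \<P>(\<omega> in M. l * nat \<lfloor>x\<rfloor> \<le> LIS (\<lambda>u. S u \<omega>) n)"
  proof (rule finite_measure_mono)
    have "real (l * nat \<lfloor>x\<rfloor>) \<le> real l * x"
      using assms(2) by (simp add: mult_left_mono)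
    then have "l * nat \<lfloor>x\<rfloor> \<le> k" if "real l * x \<le> real k" for k
      using that by (metis of_nat_le_iff order_trans)
    then show "{\<omega>\<in>space M. real l * x \<le> real (LIS (partial_sum X \<omega>) n)}
        \<subseteq> {\<omega>\<in>space M. l * nat \<lfloor>x\<rfloor> \<le> LIS (\<lambda>u. S u \<omega>) n}"
      by blast
    show "{\<omega>\<in>space M. l * nat \<lfloor>x\<rfloor> \<le> LIS (\<lambda>u. S u \<omega>) n} \<in> events"
      using pred_LIS_ge[of n "\<lambda>\<omega> u. S u \<omega>" M "l * nat \<lfloor>x\<rfloor>", OF S_measurable] by (simp only: pred_def)
  qed
  also have "\<dots> \<le> p ^ l" by (rule prob_LIS_power[OF assms(1)])
  finally show ?thesis .
qed

lemma eventually_scale_large: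
  "\<forall>\<^sub>F n in sequentially. 1 \<le> log 4 (real n) \<and> 16 * \<sigma>\<^sup>2 * (log 4 (real n))\<^sup>2 \<le> 2 powr (scale_exponent (log 4 (real n)))"
proof -
  have "\<forall>\<^sub>F N in at_top. N\<^sup>2 * 2 powr (- scale_exponent N) < 1 / (16 * \<sigma>\<^sup>2)"
    using scale_exponent_asymptotics(6) by (rule order_tendstoD(2)) (use \<sigma>_pos in simp)
  with eventually_ge_at_top[of "1::real"]
  have "\<forall>\<^sub>F N in at_top. 1 \<le> N \<and> 16 * \<sigma>\<^sup>2 * N\<^sup>2 \<le> 2 powr (scale_exponent N)"
  proof eventually_elim
    case (elim N)
    then show ?case using \<sigma>_pos by (simp add: powr_minus field_simps)
  qed
  from eventually_compose_filterlim[OF this log4_at_top] show ?thesis .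
qed

lemma eventually_prob_LIS_le:
  "\<forall>\<^sub>F n in sequentially. \<forall>l.
    \<P>(\<omega> in M. real l * LIS_bound n \<le> real (LIS (partial_sum X \<omega>) n)) \<le> (2 / log 4 n) ^ (2 * l)"
proof -
  have ev: "\<forall>\<^sub>F n in sequentially. 2 powr (- log 4 (real n)) / 2 \<le> 1 / (log 4 (real n))\<^sup>2"
    by (rule eventually_compose_filterlim[OF scale_exponent_asymptotics(5) log4_at_top])
  from eventually_prob_LIS_window_le eventually_scale_large ev eventually_ge_at_top[of 1]
  show ?thesis
  proof eventually_elim
    case (elim n)
    let ?N = "log 4 (real n)" and ?L = "scale_exponent (log 4 (real n))"
    have R: "(2 powr (?L / 2))\<^sup>2 = 2 powr ?L" by (simp add: powr_power)
    have Rpos: "0 < (2::real) powr (?L / 2)" by simp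
    have N1: "1 \<le> ?N" using elim(2) by simp
    have "16 * \<sigma>\<^sup>2 * 1 \<le> 16 * \<sigma>\<^sup>2 * ?N\<^sup>2" using N1 by (intro mult_left_mono one_le_power) auto
    then have big: "16 * \<sigma>\<^sup>2 \<le> (2 powr (?L / 2))\<^sup>2" using elim(2) R by linarith
    have "\<P>(\<omega> in M. nat \<lfloor>LIS_bound n\<rfloor> \<le> LIS (\<lambda>u. S (a + u) \<omega>) n) \<le> (2 / ?N)\<^sup>2" for a
    proof -
      have "6 * \<sigma>\<^sup>2 / (2 powr (?L / 2))\<^sup>2 \<le> 6 * \<sigma>\<^sup>2 / (16 * \<sigma>\<^sup>2 * ?N\<^sup>2)"
        unfolding R using elim(2) \<sigma>_pos N1 by (intro divide_left_mono mult_pos_pos) auto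
      also have "\<dots> \<le> 1 / ?N\<^sup>2" using \<sigma>_pos by (simp add: divide_simps)
      finally have "6 * \<sigma>\<^sup>2 / (2 powr (?L / 2))\<^sup>2 \<le> 1 / ?N\<^sup>2" .
      moreover have "(2 / ?N)\<^sup>2 = 4 * (1 / ?N\<^sup>2)" "0 \<le> 1 / ?N\<^sup>2" by (simp_all add: power_divide)
      moreover note elim(1)[rule_format, of a] elim(3) prob_max_le_second_moment[OF Rpos big elim(4), of a]
      ultimately show ?thesis by linarith
    qed
    from prob_LIS_ge_multiple[OF this]
    show ?case by (simp add: power_mult)
  qed
qed

lemma eventually_prob_LIS_le_exponential:
  assumes t: "t > 0" and int: "integrable M (\<lambda>\<omega>. exp (t * \<bar>X 1 \<omega>\<bar>))"
  shows "\<forall>\<^sub>F n in sequentially. \<forall>l.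
    \<P>(\<omega> in M. real l * LIS_bound n \<le> real (LIS (partial_sum X \<omega>) n)) \<le> real n powr (- real l / 2)"
proof -
  define C where "C = 4 / t\<^sup>2 * expectation (\<lambda>\<omega>. exp (t * \<bar>X 1 \<omega>\<bar>))"
  have "\<forall>\<^sub>F N in at_top. N / 2 powr (scale_exponent N / 2) < 1 / 4"
    using scale_exponent_asymptotics(7) by (rule order_tendstoD(2)) simp
  then have "\<forall>\<^sub>F N in at_top. N / 2 powr (scale_exponent N / 2) < 1 / 4 \<and> C + 5 \<le> N"
    by (intro eventually_conj eventually_ge_at_top)
  from eventually_compose_filterlim[OF this log4_at_top]
  have ev: "\<forall>\<^sub>F n in sequentially. log 4 (real n) / 2 powr (scale_exponent (log 4 (real n)) / 2) < 1 / 4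
      \<and> C + 5 \<le> log 4 (real n)" .
  have "(\<lambda>n. 1 / sqrt (real n)) \<longlonglongrightarrow> 0" by real_asymp
  then have "\<forall>\<^sub>F n in sequentially. 1 / sqrt (real n) < t / 2"
    by (rule order_tendstoD(2)) (use t in simp)
  with eventually_prob_LIS_window_le eventually_scale_large ev eventually_ge_at_top[of 1]
  show ?thesis
  proof eventually_elim
    case (elim n)
    let ?N = "log 4 (real n)" and ?L = "scale_exponent (log 4 (real n))"
    define R where "R = 2 powr (?L / 2)"
    have R0: "R > 0" by (simp add: R_def)
    have R2: "R\<^sup>2 = 2 powr ?L" by (simp add: powr_power R_def)
    have N1: "1 \<le> ?N" using elim(2) by simp
    have "16 * \<sigma>\<^sup>2 * 1 \<le> 16 * \<sigma>\<^sup>2 * ?N\<^sup>2" using N1 by (intro mult_left_mono one_le_power) auto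
    then have "16 * \<sigma>\<^sup>2 \<le> R\<^sup>2" using elim(2) R2 by linarith
    then have "16 * \<sigma>\<^sup>2 * real n \<le> R\<^sup>2 * real n" by (rule mult_right_mono) simp
    then have big: "16 * \<sigma>\<^sup>2 * real n \<le> (R * sqrt n)\<^sup>2" by (simp add: power_mult_distrib)
    have H0: "R * sqrt n > 0" using R0 elim(4) by simp
    have "?N < 1 / 4 * R" using elim(3) R0 by (simp only: R_def[symmetric] pos_divide_less_eq)
    \<comment> \<open>The constant 5 makes up for the factors 4/3 and 2 in the tail bound for the range.\<close>
    then have "C - R / 2 \<le> - ?N - 5" using elim(3) by linarith
    then have "exp (C - R / 2) \<le> exp (- ?N) * exp (- 5)" by (simp add: exp_add[symmetric])
    also have "\<dots> \<le> 2 powr (- ?N) * (1 / 6)"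
    proof (rule mult_mono)
      have "ln 2 \<le> (1::real)" using ln_le_minus_one[of "2::real"] by simp
      then have "?N * ln 2 \<le> ?N" using N1 by (simp add: mult_left_le)
      then show "exp (- ?N) \<le> 2 powr (- ?N)" by (simp add: powr_def)
      have "6 \<le> exp (5::real)" using exp_ge_add_one_self[of 5] by simp
      then show "exp (- 5) \<le> (1 / 6 :: real)" by (simp add: exp_minus divide_simps)
    qed auto
    finally have ex: "exp (C - R / 2) \<le> 2 powr (- ?N) * (1 / 6)" .
    have "\<P>(\<omega> in M. nat \<lfloor>LIS_bound n\<rfloor> \<le> LIS (\<lambda>u. S (a + u) \<omega>) n) \<le> 2 powr (- ?N)" for a
    proof -
      have "3/4 * \<P>(\<omega> in M. \<exists>t<n. R * sqrt n < \<bar>S (a + t) \<omega> - S a \<omega>\<bar>)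
          \<le> \<P>(\<omega> in M. R * sqrt n / 2 \<le> \<bar>S (a + n) \<omega> - S a \<omega>\<bar>)"
        by (rule prob_max_le[OF H0 big])
      also have "R * sqrt n / 2 = (R / 2) * sqrt n" by simp
      also have "\<P>(\<omega> in M. (R / 2) * sqrt n \<le> \<bar>S (a + n) \<omega> - S a \<omega>\<bar>) \<le> 2 * exp (C - R / 2)"
        unfolding C_def using elim(4,5) by (intro increment_exponential_tail[OF t int]) auto
      finally have "\<P>(\<omega> in M. \<exists>t<n. R * sqrt n < \<bar>S (a + t) \<omega> - S a \<omega>\<bar>) \<le> 2 powr (- ?N) / 2"
        using ex powr_gt_zero[of 2 "- ?N"] by linarith
      then show ?thesis using elim(1)[rule_format, of a] unfolding R_def by linarith
    qed
    from prob_LIS_ge_multiple[OF this]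
    have "\<P>(\<omega> in M. real l * LIS_bound n \<le> real (LIS (partial_sum X \<omega>) n)) \<le> (2 powr (- ?N)) ^ l" for l
      by simp
    also have "(2 powr (- ?N)) ^ l = real n powr (- real l / 2)" for l
    proof -
      have "2 powr (- ?N) = real n powr (- (1 / 2))"
        using powr_log4(2)[OF elim(4)] elim(4) by (simp add: powr_minus powr_half_sqrt)
      then show ?thesis using elim(4) by (simp add: powr_power mult.commute)
    qed
    finally show ?case by blast
  qed
qed

end

theorem theorem1:
  fixes M :: "'a measure" and X :: "nat \<Rightarrow> 'a \<Rightarrow> real"
  assumes "prob_space M"
    and indep: "prob_space.indep_vars M (\<lambda>_. borel) X {1..}"
    and ident: "\<And>i. i \<ge> 1 \<Longrightarrow> distr M borel (X i) = distr M borel (X 1)"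
    and "integrable M (X 1)"
    and mean: "prob_space.expectation M (X 1) = 0"
    and "integrable M (\<lambda>\<omega>. (X 1 \<omega>)\<^sup>2)"
    and var: "0 < prob_space.variance M (X 1)"
  shows
    "(\<forall>\<^sub>F n in sequentially. \<forall>l::nat. l \<ge> 1 \<longrightarrow>
        \<P>(\<omega> in M. real (LIS (partial_sum X \<omega>) n)
            \<ge> real l * sqrt (real n) * 2 powr (5 * sqrt (log 4 n * log 4 (log 4 n))))
          \<le> (2 / log 4 n) ^ (2 * l))
     \<and> ((\<exists>t>0. integrable M (\<lambda>\<omega>. exp (t * \<bar>X 1 \<omega>\<bar>))) \<longrightarrow>
        (\<forall>\<^sub>F n in sequentially. \<forall>l::nat. l \<ge> 1 \<longrightarrow>
          \<P>(\<omega> in M. real (LIS (partial_sum X \<omega>) n)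
              \<ge> real l * sqrt (real n) * 2 powr (5 * sqrt (log 4 n * log 4 (log 4 n))))
            \<le> real n powr (- real l / 2)))"
proof -
  interpret prob_space M by (rule assms(1))
  interpret random_walk M X "sqrt (variance (X 1))"
  proof
    show "0 < sqrt (variance (X 1))" "variance (X 1) = (sqrt (variance (X 1)))\<^sup>2"
      using var by simp_all
  qed (fact assms)+
  have threshold: "real l * LIS_bound n
      = real l * sqrt (real n) * 2 powr (5 * sqrt (log 4 n * log 4 (log 4 n)))" for l n
    by (simp only: scale_exponent_def mult.assoc)
  show ?thesis
  proof (intro conjI impI)
    show "\<forall>\<^sub>F n in sequentially. \<forall>l::nat. l \<ge> 1 \<longrightarrow>
        \<P>(\<omega> in M. real (LIS (partial_sum X \<omega>) n)
            \<ge> real l * sqrt (real n) * 2 powr (5 * sqrt (log 4 n * log 4 (log 4 n))))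
          \<le> (2 / log 4 n) ^ (2 * l)"
      using eventually_prob_LIS_le unfolding threshold by (rule eventually_mono) blast
  next
    assume "\<exists>t>0. integrable M (\<lambda>\<omega>. exp (t * \<bar>X 1 \<omega>\<bar>))"
    then obtain t where "t > 0" "integrable M (\<lambda>\<omega>. exp (t * \<bar>X 1 \<omega>\<bar>))" by blast
    from eventually_prob_LIS_le_exponential[OF this]
    show "\<forall>\<^sub>F n in sequentially. \<forall>l::nat. l \<ge> 1 \<longrightarrow>
          \<P>(\<omega> in M. real (LIS (partial_sum X \<omega>) n)
              \<ge> real l * sqrt (real n) * 2 powr (5 * sqrt (log 4 n * log 4 (log 4 n))))
            \<le> real n powr (- real l / 2)"
      unfolding threshold by (rule eventually_mono) blast
  qed
qed

end
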